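(* Fix $0<\epsilon\le 1$. For $n\ge 2$ let $\mathrm{conv}_n\colon\mathbb{C}^n\times\mathbb{C}^n\to\mathbb{C}^n$ be the cyclic convolution, $\mathrm{conv}_n(a,b)=(c_0,\dots,c_{n-1})$ with $c_k=\sum_{0\le i,j<n,\ i+j\equiv k\bmod n}a_ib_j$. Then the minimal size of a bilinear circuit computing $\mathrm{conv}_n$ in which at most $(1-\epsilon)n$ scalar multiplications use scalars of absolute value greater than $2$ (all other scalar multiplications using scalars of absolute value at most $2$) is $\Omega(n\log n)$, where the implied constant depends only on $\epsilon$.
   Context: A circuit over $\mathbb{C}$ is a sequence of instructions, each forming $u\circ v$ ($\circ\in\{+,-,*\}$) from previously computed values or inputs, or $\lambda u$ for a scalar $\lambda\in\mathbb{C}$; its size is the number of instructions. A linear circuit uses only $+,-$ and scalar multiplications. A bilinear circuit on inputs $X_1,\dots,X_m,Y_1,\dots,Y_n$ consists of four consecutive parts: a linear circuit on the $X_i$ computing linear forms $f_1,\dots,f_k$; a linear circuit on the $Y_j$ computing linear forms $g_1,\dots,g_\ell$; a part consisting only of multiplications $f_i\cdot g_j$; and a linear circuit taking these products as inputs. Scalar multiplications by constants of absolute value greater than $2$ are called help gates; here the help gates may occur in any of the four parts, and the total number of them is at most $(1-\epsilon)n$. *)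

theory Defs
  imports Complex_Main
begin

text \<open>
  Circuits over the complex numbers. An operand is an input \<open>X i\<close> or \<open>Y j\<close>
  (numbered from \<open>0\<close>) or the result \<open>Res t\<close> of the instruction at position \<open>t\<close>
  of the whole sequence.
\<close>

datatype operand = X nat | Y nat | Res nat

datatype instr =
    Add operand operand
  | Sub operand operand
  | Mul operand operand
  | Scale complex operand

fun operands :: "instr \<Rightarrow> operand set" where
  "operands (Add u v) = {u, v}"
| "operands (Sub u v) = {u, v}"
| "operands (Mul u v) = {u, v}"
| "operands (Scale c u) = {u}"

fun linear_instr :: "instr \<Rightarrow> bool" where
  "linear_instr (Mul u v) = False"
| "linear_instr _ = True"

fun operand_val ::
  "(nat \<Rightarrow> complex) \<Rightarrow> (nat \<Rightarrow> complex) \<Rightarrow> complex list \<Rightarrow> operand \<Rightarrow> complex" where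
  "operand_val a b rs (X i) = a i"
| "operand_val a b rs (Y j) = b j"
| "operand_val a b rs (Res t) = rs ! t"

fun instr_val ::
  "(nat \<Rightarrow> complex) \<Rightarrow> (nat \<Rightarrow> complex) \<Rightarrow> complex list \<Rightarrow> instr \<Rightarrow> complex" where
  "instr_val a b rs (Add u v) = operand_val a b rs u + operand_val a b rs v"
| "instr_val a b rs (Sub u v) = operand_val a b rs u - operand_val a b rs v"
| "instr_val a b rs (Mul u v) = operand_val a b rs u * operand_val a b rs v"
| "instr_val a b rs (Scale c u) = c * operand_val a b rs u"

text \<open>The list of the results of all instructions, in order, on the inputs \<open>a\<close>, \<open>b\<close>.\<close>

definition run :: "(nat \<Rightarrow> complex) \<Rightarrow> (nat \<Rightarrow> complex) \<Rightarrow> instr list \<Rightarrow> complex list" where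
  "run a b C = foldl (\<lambda>rs g. rs @ [instr_val a b rs g]) [] C"

text \<open>
  A segment \<open>p\<close> that starts at position \<open>s\<close> of the whole sequence is a circuit
  with inputs \<open>I\<close> if each instruction uses only elements of \<open>I\<close> and earlier results of
  the segment itself.
\<close>

definition circuit :: "operand set \<Rightarrow> nat \<Rightarrow> instr list \<Rightarrow> bool" where
  "circuit I s p \<longleftrightarrow>
     (\<forall>t<length p. operands (p ! t) \<subseteq> I \<union> Res ` {s..<s + t})"

definition linear_circuit :: "operand set \<Rightarrow> nat \<Rightarrow> instr list \<Rightarrow> bool" where
  "linear_circuit I s p \<longleftrightarrow> circuit I s p \<and> (\<forall>g\<in>set p. linear_instr g)"

text \<open>
  In a product of the third part, the first factor may be any value available
  in the first part, inputs included, and likewise for the second factor and the second part.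
\<close>

definition bilinear_circuit :: "nat \<Rightarrow> nat \<Rightarrow> instr list \<Rightarrow> bool" where
  "bilinear_circuit m n C \<longleftrightarrow>
     (\<exists>p1 p2 p3 p4.
        C = p1 @ p2 @ p3 @ p4 \<and>
        linear_circuit (X ` {..<m}) 0 p1 \<and>
        linear_circuit (Y ` {..<n}) (length p1) p2 \<and>
        (\<forall>g\<in>set p3.
           \<exists>u \<in> X ` {..<m} \<union> Res ` {..<length p1}.
           \<exists>v \<in> Y ` {..<n} \<union> Res ` {length p1..<length (p1 @ p2)}.
             g = Mul u v) \<and>
        linear_circuit (Res ` {length (p1 @ p2)..<length (p1 @ p2 @ p3)})
          (length (p1 @ p2 @ p3)) p4)"

text \<open>
  \<open>C\<close> computes the first \<open>q\<close> components of \<open>f\<close>. The result position of a component must not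
  depend on the inputs. Over the infinite field of complex numbers, agreement as functions is
  agreement as polynomials.
\<close>

definition computes ::
  "instr list \<Rightarrow> nat \<Rightarrow> ((nat \<Rightarrow> complex) \<Rightarrow> (nat \<Rightarrow> complex) \<Rightarrow> nat \<Rightarrow> complex) \<Rightarrow> bool" where
  "computes C q f \<longleftrightarrow> (\<forall>k<q. \<exists>t<length C. \<forall>a b. run a b C ! t = f a b k)"

fun help_gate :: "instr \<Rightarrow> bool" where
  "help_gate (Scale c u) \<longleftrightarrow> cmod c > 2"
| "help_gate _ \<longleftrightarrow> False"

definition num_help_gates :: "instr list \<Rightarrow> nat" where
  "num_help_gates C = length (filter help_gate C)"

text \<open>Vectors of length \<open>n\<close> are functions on \<open>nat\<close> of which only the values below \<open>n\<close> matter.\<close>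

definition conv ::
  "nat \<Rightarrow> (nat \<Rightarrow> complex) \<Rightarrow> (nat \<Rightarrow> complex) \<Rightarrow> nat \<Rightarrow> complex" where
  "conv n a b k = (\<Sum>(i, j) \<in> {(i, j). i < n \<and> j < n \<and> (i + j) mod n = k mod n}. a i * b j)"

text \<open>
  For \<open>n \<ge> 1\<close> and \<open>\<epsilon> \<le> 1\<close> the minimum is over a nonempty set: forming all products
  \<open>X i * Y j\<close> and adding them up needs no scalar multiplication.
\<close>

definition min_size_conv :: "real \<Rightarrow> nat \<Rightarrow> nat" where
  "min_size_conv \<epsilon> n =
     (LEAST s. \<exists>C. bilinear_circuit n n C \<and> computes C n (conv n) \<and>
        real (num_help_gates C) \<le> (1 - \<epsilon>) * real n \<and> length C = s)"

end

theory Submission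
  imports Defs "Jordan_Normal_Form.Char_Poly"
begin

text \<open>
  Restricting the inputs to the subspaces where the help gates vanish costs as many dimensions as
  there are help gates, and there every gate is bounded. A determinant argument in the style of
  Morgenstern then controls linear circuits: starting from \<open>|x|\<^sup>2\<close> and adding
  \<open>|w x|\<^sup>2\<close> for each computed form \<open>w\<close>, each step multiplies the Gram
  determinant by at most a constant. Applied to the first part of a circuit of size
  \<open>o (n ln n)\<close>, it gives a subspace \<open>U\<close> of small further codimension on which all
  left factors satisfy \<open>|f a|\<^sup>2 \<le> sqrt n * |a|\<^sup>2\<close>. A choice of signs (Bang's
  argument for the plank problem) in a basis adapted to the left factors yields \<open>a \<in> U\<close>
  such that \<open>\<Sum> |f a|\<^sup>2\<close> is linear in the number of products, while \<open>a\<close>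
  has almost \<open>dim U\<close> Fourier coefficients that are not small. For this fixed \<open>a\<close>,
  the convolution with \<open>a\<close> is computed by a linear circuit in \<open>b\<close> whose scalings
  \<open>f a\<close> enlarge the determinant by at most \<open>exp (\<Sum> |f a|\<^sup>2)\<close>. As it
  expands a subspace of dimension proportional to \<open>n\<close> by a power of \<open>n\<close>, the
  circuit has \<open>\<Omega>(n ln n)\<close> gates.
\<close>

section \<open>Growth of Gram determinants\<close>

text \<open>The block matrix \<open>?T\<close> factors both as \<open>?L * ?R\<close> and as
  \<open>?R' * ?L\<close>. Since \<open>det ?L = 1\<close>, comparing determinants turns a rank-one
  perturbation of size \<open>m\<close> into one of size 1.\<close>

lemma det_one_plus_col_row:
  fixes U W :: "'a::idom mat"
  assumes U: "U \<in> carrier_mat m 1" and W: "W \<in> carrier_mat 1 m"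
  shows "det (1\<^sub>m m + U * W) = 1 + (W * U) $$ (0, 0)"
proof -
  let ?T = "four_block_mat (1\<^sub>m 1) (- W) U (1\<^sub>m m)"
  let ?L = "four_block_mat (1\<^sub>m 1) (0\<^sub>m 1 m) U (1\<^sub>m m)"
  let ?R = "four_block_mat (1\<^sub>m 1) (- W) (0\<^sub>m m 1) (1\<^sub>m m + U * W)"
  let ?R' = "four_block_mat (1\<^sub>m 1 + W * U) (- W) (0\<^sub>m m 1) (1\<^sub>m m)"
  have UW: "U * W \<in> carrier_mat m m" and WU: "W * U \<in> carrier_mat 1 1"
    using U W by auto
  have c1: "U * - W + (1\<^sub>m m + U * W) = 1\<^sub>m m"
    using UW U W by (intro eq_matI) auto
  have c2: "1\<^sub>m 1 + W * U + - W * U = 1\<^sub>m 1"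
    using WU U W by (intro eq_matI) auto
  have detL: "det ?L = 1"
    by (subst det_four_block_mat_upper_right_zero[of _ 1 _ m]) (use U in auto)
  have "det (1\<^sub>m m + U * W) = det ?R"
    by (subst det_four_block_mat_lower_left_zero[of _ 1 _ m]) (use U W UW in auto)
  also have "\<dots> = det ?L * det ?R"
    unfolding detL by (rule mult_1_left[symmetric])
  also have "\<dots> = det (?L * ?R)"
    by (rule det_mult[symmetric, of _ "1 + m"]) (use U W in auto)
  also have "?L * ?R = ?T"
    by (subst mult_four_block_mat[of _ 1 1 _ m _ m _ _ 1 _ m]) (use U W c1 in auto)
  also have "?T = ?R' * ?L"
    by (subst mult_four_block_mat[of _ 1 1 _ m _ m _ _ 1 _ m]) (use U W c2 in auto)
  also have "det \<dots> = det ?R' * det ?L"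
    by (rule det_mult[of _ "1 + m"]) (use U W in auto)
  also have "\<dots> = det (1\<^sub>m 1 + W * U)"
    by (subst det_four_block_mat_lower_left_zero[of _ 1 _ m]) (use U W UW detL in auto)
  also have "\<dots> = 1 + (W * U) $$ (0, 0)"
    using WU W U by (subst det_single) auto
  finally show ?thesis .
qed

text \<open>Up to sign the determinant is the characteristic polynomial at 0, hence in modulus the
  product of the moduli of the \<open>m\<close> eigenvalues with multiplicity.\<close>

lemma power_le_cmod_det:
  fixes A :: "complex mat"
  assumes A: "A \<in> carrier_mat m m" and s: "0 \<le> s"
    and ev: "\<And>k. eigenvalue A k \<Longrightarrow> s \<le> cmod k"
  shows "s ^ m \<le> cmod (det A)"
proof -
  obtain as where as: "char_poly A = (\<Prod>a\<leftarrow>as. [:- a, 1:])" "length as = m"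
    using char_poly_factorized[OF A] by blast
  have ge: "s \<le> cmod a" if "a \<in> set as" for a
  proof (rule ev)
    show "eigenvalue A a"
      unfolding eigenvalue_root_char_poly[OF A] as poly_prod_list
      using that by (auto simp: prod_list_zero_iff)
  qed
  have "- char_matrix A 0 = (-1) \<cdot>\<^sub>m A"
    using A by (intro eq_matI) (auto simp: char_matrix_def)
  then have "poly (char_poly A) 0 = (-1) ^ m * det A"
    using A by (simp add: char_poly_matrix[OF A])
  then have "cmod (det A) = cmod (poly (char_poly A) 0)"
    by (simp add: norm_mult norm_power)
  also have "\<dots> = (\<Prod>a\<leftarrow>as. cmod a)"
    unfolding as(1) by (induction as) (auto simp: norm_mult)
  finally have "cmod (det A) = (\<Prod>a\<leftarrow>as. cmod a)" .
  moreover have "s ^ length bs \<le> (\<Prod>a\<leftarrow>bs. cmod a)" if "set bs \<subseteq> set as" for bs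
    using that by (induction bs) (auto intro!: mult_mono ge s zero_le_power prod_list_nonneg)
  ultimately show ?thesis
    using as(2) by auto
qed

definition energy :: "(nat \<Rightarrow> complex vec) \<Rightarrow> nat \<Rightarrow> complex vec \<Rightarrow> real" where
  "energy v t c = (\<Sum>s<t. (cmod (v s \<bullet> c))\<^sup>2)"

lemma energy_nonneg: "0 \<le> energy v t c"
  by (simp add: energy_def sum_nonneg)

lemma energy_mono: "t \<le> t' \<Longrightarrow> energy v t c \<le> energy v t' c"
  unfolding energy_def by (intro sum_mono2) auto

text \<open>With the first \<open>t\<close> vectors as rows of V this is V^H V. The product
  \<open>v s \<bullet> c\<close> carries no conjugation, so the conjugate falls on the row index and
  the quadratic form is \<open>energy\<close>.\<close>

definition gram :: "nat \<Rightarrow> (nat \<Rightarrow> complex vec) \<Rightarrow> nat \<Rightarrow> complex mat" where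
  "gram m v t = mat m m (\<lambda>(k, l). \<Sum>s<t. cnj (v s $ k) * v s $ l)"

lemma gram_carrier [simp]: "gram m v t \<in> carrier_mat m m"
  by (simp add: gram_def)

lemma gram_mult_vec:
  assumes c: "c \<in> carrier_vec m" and v: "\<And>s. v s \<in> carrier_vec m" and k: "k < m"
  shows "(gram m v t *\<^sub>v c) $ k = (\<Sum>s<t. cnj (v s $ k) * (v s \<bullet> c))"
proof -
  have "(gram m v t *\<^sub>v c) $ k = (\<Sum>l<m. (\<Sum>s<t. cnj (v s $ k) * v s $ l) * c $ l)"
    using c k by (simp add: gram_def scalar_prod_def atLeast0LessThan)
  also have "\<dots> = (\<Sum>s<t. \<Sum>l<m. cnj (v s $ k) * v s $ l * c $ l)"
    by (subst sum.swap) (simp add: sum_distrib_right)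
  also have "\<dots> = (\<Sum>s<t. cnj (v s $ k) * (v s \<bullet> c))"
    using c by (simp add: scalar_prod_def atLeast0LessThan sum_distrib_left mult.assoc)
  finally show ?thesis .
qed

lemma energy_eq_gram:
  assumes c: "c \<in> carrier_vec m" and v: "\<And>s. v s \<in> carrier_vec m"
  shows "(\<Sum>k<m. cnj (c $ k) * (gram m v t *\<^sub>v c) $ k) = of_real (energy v t c)"
proof -
  have "(\<Sum>k<m. cnj (c $ k) * (gram m v t *\<^sub>v c) $ k)
      = (\<Sum>k<m. cnj (c $ k) * (\<Sum>s<t. cnj (v s $ k) * (v s \<bullet> c)))"
    by (intro sum.cong refl) (use c v in \<open>simp add: gram_mult_vec\<close>)
  also have "\<dots> = (\<Sum>s<t. \<Sum>k<m. cnj (c $ k) * (cnj (v s $ k) * (v s \<bullet> c)))"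
    by (subst sum.swap) (simp add: sum_distrib_left)
  also have "\<dots> = (\<Sum>s<t. cnj (v s \<bullet> c) * (v s \<bullet> c))"
  proof (intro sum.cong refl)
    have "(\<Sum>k<m. cnj (c $ k) * (cnj (v s $ k) * z)) = cnj (v s \<bullet> c) * z" for s z
      using c by (simp add: scalar_prod_def atLeast0LessThan sum_distrib_right sum_distrib_left mult_ac)
    then show "(\<Sum>k<m. cnj (c $ k) * (cnj (v s $ k) * (v s \<bullet> c))) = cnj (v s \<bullet> c) * (v s \<bullet> c)" for s .
  qed
  also have "\<dots> = of_real (energy v t c)"
    by (simp only: energy_def of_real_sum complex_norm_square mult.commute)
  finally show ?thesis .
qed

text \<open>By the matrix determinant lemma, the Gram determinant gains at step \<open>t\<close> the factor
  \<open>1 + |v t|\<^sup>2\<close>, where the norm is dual to the current energy.\<close>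

lemma energy_growth:
  assumes v: "\<And>s. v s \<in> carrier_vec m"
    and nN: "n \<le> N" and s: "0 \<le> s"
    and pos: "\<And>c. c \<in> carrier_vec m \<Longrightarrow> c \<noteq> 0\<^sub>v m \<Longrightarrow> 0 < energy v n c"
    and \<kappa>: "\<And>t. 0 \<le> \<kappa> t"
    and step: "\<And>t c. n \<le> t \<Longrightarrow> t < N \<Longrightarrow> c \<in> carrier_vec m \<Longrightarrow>
                 (cmod (v t \<bullet> c))\<^sup>2 \<le> \<kappa> t * energy v t c"
    and growth: "\<And>c. c \<in> carrier_vec m \<Longrightarrow> s * energy v n c \<le> energy v N c"
  shows "s ^ m \<le> (\<Prod>t\<in>{n..<N}. 1 + \<kappa> t)"
proof -
  let ?H = "gram m v"
  have H[simp]: "?H t \<in> carrier_mat m m" for t by simp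
  have [simp]: "dim_row (?H t) = m" "dim_col (?H t) = m" for t by (simp_all add: gram_def)
  \<comment> \<open>A kernel vector of the Gram matrix would have energy 0, against
    \<open>pos\<close>.\<close>
  have nz: "det (?H t) \<noteq> 0" if t: "n \<le> t" for t
  proof
    assume "det (?H t) = 0"
    then obtain c where c: "c \<in> carrier_vec m" "c \<noteq> 0\<^sub>v m" "?H t *\<^sub>v c = 0\<^sub>v m"
      using det_0_iff_vec_prod_zero_field[OF H] by blast
    have "complex_of_real (energy v t c) = 0"
      unfolding energy_eq_gram[OF c(1) v, symmetric] by (simp add: c(3))
    with pos[OF c(1,2)] energy_mono[OF t, of v c] show False by simp
  qed
  have inv: "\<exists>B. B \<in> carrier_mat m m \<and> ?H t * B = 1\<^sub>m m" if "n \<le> t" for t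
    using det_non_zero_imp_unit[OF H nz[OF that], of "()"]
    by (auto simp: Units_def ring_mat_simps)
  have upd: "cmod (det (?H (Suc t))) \<le> (1 + \<kappa> t) * cmod (det (?H t))"
    if t: "n \<le> t" "t < N" for t
  proof -
    obtain B where B: "B \<in> carrier_mat m m" "?H t * B = 1\<^sub>m m" using inv[OF t(1)] by blast
    define C where "C = mat m 1 (\<lambda>(k, _). cnj (v t $ k))"
    define W where "W = mat 1 m (\<lambda>(_, l). v t $ l)"
    have C: "C \<in> carrier_mat m 1" and W: "W \<in> carrier_mat 1 m" by (auto simp: C_def W_def)
    have HBC: "?H t * (B * C) = C"
      using B C by (simp add: assoc_mult_mat[symmetric, OF H B(1) C])
    have BC: "B * C \<in> carrier_mat m 1" using B C by simp
    have "?H (Suc t) = ?H t + C * W"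
      by (rule eq_matI) (auto simp: gram_def C_def W_def scalar_prod_def)
    also have "\<dots> = ?H t * (1\<^sub>m m + (B * C) * W)"
      using HBC BC W by (simp add: mult_add_distrib_mat[of _ m m _ m] 
        assoc_mult_mat[symmetric, OF H BC W])
    finally have d: "det (?H (Suc t)) = det (?H t) * (1 + (W * (B * C)) $$ (0, 0))"
      using BC W by (simp add: det_mult[of _ m] det_one_plus_col_row[OF BC W])
    \<comment> \<open>\<open>c\<close> is the inverse Gram matrix applied to the conjugate of
      \<open>v t\<close>. Its energy and the modulus of \<open>v t \<bullet> c\<close> both equal
      the squared dual norm of \<open>v t\<close>, so \<open>step\<close> at this \<open>c\<close>
      bounds that norm by \<open>\<kappa> t\<close>.\<close>
    define c where "c = col (B * C) 0"
    have c: "c \<in> carrier_vec m" using B by (simp add: c_def carrier_vecI)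
    have "row W 0 = v t" using v[of t] by (intro eq_vecI) (auto simp: W_def)
    then have z: "(W * (B * C)) $$ (0, 0) = v t \<bullet> c"
      using W BC C by (simp add: c_def)
    have "(?H t *\<^sub>v c) $ k = cnj (v t $ k)" if "k < m" for k
    proof -
      have "(?H t *\<^sub>v c) $ k = (?H t * (B * C)) $$ (k, 0)"
        using that BC C by (simp add: c_def)
      also have "\<dots> = cnj (v t $ k)" unfolding HBC using that by (simp add: C_def)
      finally show ?thesis .
    qed
    then have "(\<Sum>k<m. cnj (c $ k) * (?H t *\<^sub>v c) $ k) = (\<Sum>k<m. cnj (c $ k) * cnj (v t $ k))"
      by (intro sum.cong) auto
    also have "\<dots> = cnj (v t \<bullet> c)"
      using c by (simp add: scalar_prod_def atLeast0LessThan mult.commute)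
    finally have "cnj (v t \<bullet> c) = of_real (energy v t c)"
      unfolding energy_eq_gram[OF c v] ..
    then have e: "energy v t c = cmod (v t \<bullet> c)"
      by (metis complex_mod_cnj energy_nonneg norm_of_real abs_of_nonneg)
    have "cmod (v t \<bullet> c) * cmod (v t \<bullet> c) \<le> \<kappa> t * cmod (v t \<bullet> c)"
      using step[OF t c] e by (simp add: power2_eq_square)
    then have "cmod (v t \<bullet> c) \<le> \<kappa> t"
      using \<kappa>[of t] by (cases "v t \<bullet> c = 0") auto
    then have "cmod (1 + v t \<bullet> c) \<le> 1 + \<kappa> t"
      by (metis add_left_mono norm_one norm_triangle_le)
    then show ?thesis
      unfolding d z norm_mult by (subst mult.commute) (rule mult_right_mono[OF _ norm_ge_zero])
  qed
  have prod: "cmod (det (?H (n + d))) \<le> (\<Prod>t\<in>{n..<n + d}. 1 + \<kappa> t) * cmod (det (?H n))"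
    if "n + d \<le> N" for d
    using that
  proof (induction d)
    case (Suc d)
    have "cmod (det (?H (n + Suc d))) \<le> (1 + \<kappa> (n + d)) * cmod (det (?H (n + d)))"
      using upd[of "n + d"] Suc.prems by simp
    also have "\<dots> \<le> (1 + \<kappa> (n + d)) * ((\<Prod>t\<in>{n..<n + d}. 1 + \<kappa> t) * cmod (det (?H n)))"
      using Suc \<kappa>[of "n + d"] by (intro mult_left_mono) auto
    finally show ?case by (simp add: mult_ac)
  qed simp
  obtain B where B: "B \<in> carrier_mat m m" "?H n * B = 1\<^sub>m m" using inv by blast
  \<comment> \<open>An eigenvalue of this relative Gram matrix is the ratio of final to initial
    energy at an eigenvector, so \<open>growth\<close> bounds its modulus below by
    \<open>s\<close>.\<close>
  let ?A = "B * ?H N"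
  have A: "?A \<in> carrier_mat m m" using B by simp
  have HA: "?H n * ?A = ?H N"
    using B by (simp add: assoc_mult_mat[symmetric, OF H B(1) H])
  have "s ^ m \<le> cmod (det ?A)"
  proof (rule power_le_cmod_det[OF A s])
    fix k assume "eigenvalue ?A k"
    then obtain c where c: "c \<in> carrier_vec m" "c \<noteq> 0\<^sub>v m" "?A *\<^sub>v c = k \<cdot>\<^sub>v c"
      using A by (auto simp: eigenvalue_def eigenvector_def)
    have "?H N *\<^sub>v c = ?H n *\<^sub>v (?A *\<^sub>v c)"
      using assoc_mult_mat_vec[OF H A c(1), of n] unfolding HA .
    also have "\<dots> = k \<cdot>\<^sub>v (?H n *\<^sub>v c)"
      unfolding c(3) using c by (simp add: mult_mat_vec[of _ m m])
    finally have eq: "?H N *\<^sub>v c = k \<cdot>\<^sub>v (?H n *\<^sub>v c)" .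
    have "complex_of_real (energy v N c) = (\<Sum>i<m. cnj (c $ i) * (k \<cdot>\<^sub>v (?H n *\<^sub>v c)) $ i)"
      by (simp add: energy_eq_gram[OF c(1) v, symmetric] eq)
    also have "\<dots> = k * (\<Sum>i<m. cnj (c $ i) * (?H n *\<^sub>v c) $ i)"
      by (simp add: sum_distrib_left mult_ac)
    finally have "complex_of_real (energy v N c) = k * of_real (energy v n c)"
      unfolding energy_eq_gram[OF c(1) v] .
    then have "energy v N c = cmod k * energy v n c"
      by (metis norm_mult norm_of_real abs_of_nonneg energy_nonneg)
    with growth[OF c(1)] pos[OF c(1,2)] show "s \<le> cmod k" by simp
  qed
  also have "cmod (det ?A) = cmod (det (?H N)) / cmod (det (?H n))"
    using det_mult[OF H A, of n] nz[of n] unfolding HA by (simp add: norm_mult)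
  also have "\<dots> \<le> (\<Prod>t\<in>{n..<N}. 1 + \<kappa> t)"
    using prod[of "N - n"] nN nz[of n] by (simp add: field_simps)
  finally show ?thesis .
qed

section \<open>Linear and Hermitian forms on coordinate space\<close>

definition linear_form :: "((nat \<Rightarrow> complex) \<Rightarrow> complex) \<Rightarrow> bool" where
  "linear_form \<phi> \<longleftrightarrow>
     (\<forall>x y. \<phi> (\<lambda>i. x i + y i) = \<phi> x + \<phi> y) \<and> (\<forall>c x. \<phi> (\<lambda>i. c * x i) = c * \<phi> x)"

lemma linear_form_add: "linear_form \<phi> \<Longrightarrow> \<phi> (\<lambda>i. x i + y i) = \<phi> x + \<phi> y"
  and linear_form_scale: "linear_form \<phi> \<Longrightarrow> \<phi> (\<lambda>i. c * x i) = c * \<phi> x"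
  by (auto simp: linear_form_def)

lemma linear_form_zero: "linear_form \<phi> \<Longrightarrow> \<phi> (\<lambda>i. 0) = 0"
  using linear_form_scale[of \<phi> 0] by simp

lemma linear_form_sum:
  assumes "linear_form \<phi>"
  shows "\<phi> (\<lambda>i. \<Sum>l\<in>A. c l * e l i) = (\<Sum>l\<in>A. c l * \<phi> (e l))"
  by (induction A rule: infinite_finite_induct)
    (simp_all add: linear_form_zero[OF assms] linear_form_add[OF assms] linear_form_scale[OF assms])

text \<open>Gaussian elimination: a nontrivial equation \<open>i0\<close> is solved for an unknown
  \<open>j0\<close>; substitution into the others leaves one equation and one unknown less.\<close>

lemma homogeneous_system:
  fixes A :: "'i \<Rightarrow> 'j \<Rightarrow> 'a::field"
  assumes "finite I" "finite J" "card I < card J"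
  shows "\<exists>c. (\<exists>j\<in>J. c j \<noteq> 0) \<and> (\<forall>i\<in>I. (\<Sum>j\<in>J. c j * A i j) = 0)"
  using assms
proof (induction I arbitrary: J A rule: finite_induct)
  case empty
  then obtain j where "j \<in> J" by fastforce
  then show ?case by (intro exI[of _ "\<lambda>_. 1"]) auto
next
  case (insert i0 I)
  show ?case
  proof (cases "\<forall>j\<in>J. A i0 j = 0")
    case True
    obtain c where "\<exists>j\<in>J. c j \<noteq> 0" "\<forall>i\<in>I. (\<Sum>j\<in>J. c j * A i j) = 0"
      using insert.IH[of J A] insert.prems insert.hyps by auto
    with True show ?thesis by (intro exI[of _ c]) auto
  next
    case False
    then obtain j0 where j0: "j0 \<in> J" "A i0 j0 \<noteq> 0" by blast
    let ?A = "\<lambda>i j. A i j - A i j0 * A i0 j / A i0 j0"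
    have "card I < card (J - {j0})"
      using insert.prems insert.hyps j0 by simp
    then obtain c where c: "\<exists>j\<in>J-{j0}. c j \<noteq> 0"
      "\<And>i. i \<in> I \<Longrightarrow> (\<Sum>j\<in>J-{j0}. c j * ?A i j) = 0"
      using insert.IH[of "J - {j0}" ?A] insert.prems by auto
    let ?r = "(\<Sum>j\<in>J-{j0}. c j * A i0 j) / A i0 j0"
    let ?c = "c(j0 := - ?r)"
    have sum: "(\<Sum>j\<in>J. ?c j * A i j) = - ?r * A i j0 + (\<Sum>j\<in>J-{j0}. c j * A i j)" for i
      using j0(1) insert.prems(1) by (subst sum.remove[of _ j0]) (auto intro!: sum.cong)
    have "(\<Sum>j\<in>J. ?c j * A i j) = 0" if "i \<in> insert i0 I" for i
    proof (cases "i = i0")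
      case True
      then show ?thesis unfolding sum using j0 by simp
    next
      case False
      with that have "(\<Sum>j\<in>J-{j0}. c j * ?A i j) = 0" using c(2) by blast
      then have "(\<Sum>j\<in>J-{j0}. c j * A i j) = (\<Sum>j\<in>J-{j0}. c j * (A i j0 * A i0 j / A i0 j0))"
        by (simp add: right_diff_distrib sum_subtractf)
      also have "\<dots> = ?r * A i j0"
        by (simp add: sum_distrib_left sum_distrib_right sum_divide_distrib mult_ac)
      finally show ?thesis unfolding sum by simp
    qed
    moreover have "\<exists>j\<in>J. ?c j \<noteq> 0" using c(1) by auto
    ultimately show ?thesis by blast
  qed
qed

text \<open>Subspaces are given by the forms vanishing on them, so that codimension is bounded by
  counting forms. The support condition makes this a subspace of the \<open>n\<close>-dimensional
  coordinate space.\<close>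

definition zero_space :: "nat \<Rightarrow> 'i set \<Rightarrow> ('i \<Rightarrow> (nat \<Rightarrow> complex) \<Rightarrow> complex) \<Rightarrow> (nat \<Rightarrow> complex) set" where
  "zero_space n I \<phi> = {x. (\<forall>i\<ge>n. x i = 0) \<and> (\<forall>j\<in>I. \<phi> j x = 0)}"

lemma zero_space_sum:
  assumes "\<And>j. j \<in> I \<Longrightarrow> linear_form (\<phi> j)" "\<And>l. l \<in> A \<Longrightarrow> e l \<in> zero_space n I \<phi>"
  shows "(\<lambda>i. \<Sum>l\<in>A. c l * e l i) \<in> zero_space n I \<phi>"
  using assms by (auto simp: zero_space_def linear_form_sum intro!: sum.neutral)

lemma zero_space_scale:
  assumes "\<And>j. j \<in> I \<Longrightarrow> linear_form (\<phi> j)" "x \<in> zero_space n I \<phi>"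
  shows "(\<lambda>i. c * x i) \<in> zero_space n I \<phi>"
  using assms by (auto simp: zero_space_def linear_form_scale)

lemma zero_space_nontrivial:
  assumes I: "finite I" "card I < n" and \<phi>: "\<And>j. j \<in> I \<Longrightarrow> linear_form (\<phi> j)"
  shows "\<exists>x\<in>zero_space n I \<phi>. \<exists>i<n. x i \<noteq> 0"
proof -
  let ?e = "\<lambda>l i. if i = l then 1 else 0 :: complex"
  obtain c where c: "\<exists>j<n. c j \<noteq> 0" "\<And>i. i \<in> I \<Longrightarrow> (\<Sum>j<n. c j * \<phi> i (?e j)) = 0"
    using homogeneous_system[of I "{..<n}" "\<lambda>i j. \<phi> i (?e j)"] I by auto
  let ?x = "\<lambda>i. \<Sum>j<n. c j * ?e j i"
  have x: "?x i = (if i < n then c i else 0)" for i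
    by (simp add: if_distrib[of "(*) _"] sum.delta cong: if_cong)
  have zero: "?x i = 0" if "n \<le> i" for i
    using that by (simp only: x) simp
  have "\<phi> i ?x = 0" if "i \<in> I" for i
    using c(2)[OF that] by (simp only: linear_form_sum[OF \<phi>[OF that]])
  then have "?x \<in> zero_space n I \<phi>"
    unfolding zero_space_def mem_Collect_eq by (intro conjI allI impI ballI zero)
  then show ?thesis using c(1) x by (intro bexI[of _ ?x]) auto
qed

definition sqnorm :: "nat \<Rightarrow> (nat \<Rightarrow> complex) \<Rightarrow> real" where
  "sqnorm n x = (\<Sum>i<n. (cmod (x i))\<^sup>2)"

lemma sqnorm_nonneg: "0 \<le> sqnorm n x"
  by (simp add: sqnorm_def sum_nonneg)

lemma sqnorm_pos: "i < n \<Longrightarrow> x i \<noteq> 0 \<Longrightarrow> 0 < sqnorm n x"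
  unfolding sqnorm_def by (intro sum_pos2[of _ i]) auto

text \<open>Positivity is left out because \<open>ex_small_space\<close> applies this to a
  difference of two positive semidefinite forms.\<close>

definition hermitian :: "((nat \<Rightarrow> complex) \<Rightarrow> (nat \<Rightarrow> complex) \<Rightarrow> complex) \<Rightarrow> bool" where
  "hermitian F \<longleftrightarrow> (\<forall>y. linear_form (\<lambda>x. F x y)) \<and> (\<forall>x y. F y x = cnj (F x y))"

lemma hermitian_linear: "hermitian F \<Longrightarrow> linear_form (\<lambda>x. F x y)"
  and hermitian_sym: "hermitian F \<Longrightarrow> F y x = cnj (F x y)"
  unfolding hermitian_def by blast+

lemma hermitian_scale:
  assumes "hermitian F"
  shows "F (\<lambda>i. c * x i) y = c * F x y" and "F y (\<lambda>i. c * x i) = cnj c * F y x"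
proof -
  show 1: "F (\<lambda>i. c * x i) y = c * F x y" for y
    by (rule linear_form_scale[OF hermitian_linear[OF assms]])
  show "F y (\<lambda>i. c * x i) = cnj c * F y x"
    unfolding hermitian_sym[OF assms, of y] 1 by simp
qed

lemma hermitian_sum:
  assumes "hermitian F"
  shows "F (\<lambda>i. \<Sum>l\<in>A. c l * e l i) y = (\<Sum>l\<in>A. c l * F (e l) y)"
    and "F y (\<lambda>i. \<Sum>l\<in>A. c l * e l i) = (\<Sum>l\<in>A. cnj (c l) * F y (e l))"
proof -
  show 1: "F (\<lambda>i. \<Sum>l\<in>A. c l * e l i) y = (\<Sum>l\<in>A. c l * F (e l) y)" for y
    by (rule linear_form_sum[OF hermitian_linear[OF assms]])
  show "F y (\<lambda>i. \<Sum>l\<in>A. c l * e l i) = (\<Sum>l\<in>A. cnj (c l) * F y (e l))"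
    unfolding hermitian_sym[OF assms, of y] 1 by simp
qed

definition orthonormal ::
  "((nat \<Rightarrow> complex) \<Rightarrow> (nat \<Rightarrow> complex) \<Rightarrow> complex) \<Rightarrow> nat \<Rightarrow> (nat \<Rightarrow> nat \<Rightarrow> complex) \<Rightarrow> bool" where
  "orthonormal F p z \<longleftrightarrow> (\<forall>i<p. \<forall>j<p. F (z i) (z j) = (if i = j then 1 else 0))"

lemma orthonormal_form:
  assumes F: "hermitian F" and z: "orthonormal F p z"
  shows "F (\<lambda>i. \<Sum>l<p. c l * z l i) (\<lambda>i. \<Sum>l<p. d l * z l i) = (\<Sum>l<p. c l * cnj (d l))"
proof -
  have "F (\<lambda>i. \<Sum>l<p. c l * z l i) (\<lambda>i. \<Sum>l<p. d l * z l i)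
      = (\<Sum>l<p. c l * (\<Sum>k<p. cnj (d k) * F (z l) (z k)))"
    by (simp only: hermitian_sum[OF F])
  also have "\<dots> = (\<Sum>l<p. c l * (\<Sum>k<p. if l = k then cnj (d k) else 0))"
    using z by (intro sum.cong refl arg_cong2[of _ _ _ _ "(*)"]) (auto simp: orthonormal_def)
  also have "\<dots> = (\<Sum>l<p. c l * cnj (d l))"
    by (intro sum.cong refl) (simp add: sum.delta')
  finally show ?thesis .
qed

text \<open>Gram-Schmidt for a possibly indefinite form: as long as some vector of \<open>U\<close>
  orthogonal to the family has a positive value, it can be normalized and added.\<close>

lemma orthonormal_or_maximal:
  assumes F: "hermitian F" and U: "\<And>c x. x \<in> U \<Longrightarrow> (\<lambda>i. c * x i) \<in> U"
  shows "(\<exists>z. (\<forall>i<P. z i \<in> U) \<and> orthonormal F P z) \<or>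
     (\<exists>p<P. \<exists>z. (\<forall>i<p. z i \<in> U) \<and> orthonormal F p z \<and>
        (\<forall>x\<in>U. (\<forall>i<p. F x (z i) = 0) \<longrightarrow> Re (F x x) \<le> 0))"
proof (induction P)
  case 0
  then show ?case by (auto simp: orthonormal_def)
next
  case (Suc P)
  show ?case
  proof (cases "\<exists>p<P. \<exists>z. (\<forall>i<p. z i \<in> U) \<and> orthonormal F p z \<and>
        (\<forall>x\<in>U. (\<forall>i<p. F x (z i) = 0) \<longrightarrow> Re (F x x) \<le> 0)")
    case True
    then show ?thesis using less_SucI by blast
  next
    case False
    with Suc.IH obtain z where z: "\<forall>i<P. z i \<in> U" "orthonormal F P z" by blast
    show ?thesis
    proof (cases "\<forall>x\<in>U. (\<forall>i<P. F x (z i) = 0) \<longrightarrow> Re (F x x) \<le> 0")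
      case True
      with z show ?thesis by blast
    next
      case False
      then obtain x where x: "x \<in> U" "\<forall>i<P. F x (z i) = 0" "Re (F x x) > 0" by force
      define r where "r = complex_of_real (1 / sqrt (Re (F x x)))"
      define y where "y = (\<lambda>i. r * x i)"
      have Fxx: "F x x = of_real (Re (F x x))"
        using hermitian_sym[OF F, of x x] by (simp add: complex_eq_iff)
      have "F y y = r * (cnj r * F x x)"
        unfolding y_def by (simp only: hermitian_scale[OF F])
      also have "\<dots> = of_real (1 / sqrt (Re (F x x)) * (1 / sqrt (Re (F x x)) * Re (F x x)))"
        by (subst Fxx) (simp add: r_def del: of_real_divide of_real_mult flip: of_real_mult)
      also have "1 / sqrt (Re (F x x)) * (1 / sqrt (Re (F x x)) * Re (F x x)) = 1"
        using x(3) by (simp add: field_simps)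
      finally have yy: "F y y = 1" by simp
      have yz: "F y (z i) = 0" "F (z i) y = 0" if "i < P" for i
      proof -
        show "F y (z i) = 0"
          using x(2) that unfolding y_def hermitian_scale[OF F] by simp
        then show "F (z i) y = 0" by (simp add: hermitian_sym[OF F, of "z i" y])
      qed
      have "orthonormal F (Suc P) (z(P := y))"
        using z(2) yy yz by (auto simp: orthonormal_def less_Suc_eq)
      moreover have "\<forall>i<Suc P. (z(P := y)) i \<in> U"
        using z(1) x(1) U by (auto simp: y_def less_Suc_eq)
      ultimately show ?thesis by blast
    qed
  qed
qed

text \<open>Orthogonality to \<open>p < n - card I\<close> vectors adds \<open>p\<close> conditions,
  fewer than \<open>n\<close> in all, so a nonzero vector remains. Its value is positive, hence the
  family was not maximal.\<close>

lemma zero_space_orthonormal: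
  assumes F: "hermitian F" and pos: "\<And>x i. i < n \<Longrightarrow> x i \<noteq> 0 \<Longrightarrow> 0 < Re (F x x)"
    and I: "finite I" and \<phi>: "\<And>j. j \<in> I \<Longrightarrow> linear_form (\<phi> j)"
  shows "\<exists>z. (\<forall>i<n - card I. z i \<in> zero_space n I \<phi>) \<and> orthonormal F (n - card I) z"
proof (rule ccontr)
  assume "\<not> ?thesis"
  then obtain p z where p: "p < n - card I"
    "\<And>x. x \<in> zero_space n I \<phi> \<Longrightarrow> (\<And>i. i < p \<Longrightarrow> F x (z i) = 0) \<Longrightarrow> Re (F x x) \<le> 0"
    using orthonormal_or_maximal[OF F, of "zero_space n I \<phi>" "n - card I"]
      zero_space_scale[of I \<phi> _ n] \<phi> by blast
  let ?J = "Inl ` I \<union> Inr ` {..<p}"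
  let ?\<psi> = "case_sum \<phi> (\<lambda>i x. F x (z i))"
  have "card ?J \<le> card I + p"
    by (intro order.trans[OF card_Un_le] add_mono) (auto intro: card_image_le I order.trans[OF card_image_le])
  then have "card ?J < n" using p(1) by simp
  then obtain x i where x: "x \<in> zero_space n ?J ?\<psi>" "i < n" "x i \<noteq> 0"
    using zero_space_nontrivial[of ?J n ?\<psi>] I \<phi> hermitian_linear[OF F] by force
  have \<psi>: "?\<psi> j x = 0" if "j \<in> ?J" for j
    using x(1) that unfolding zero_space_def by blast
  have "Re (F x x) \<le> 0"
  proof (rule p(2))
    show "x \<in> zero_space n I \<phi>"
      using x(1) \<psi>[of "Inl _"] by (auto simp: zero_space_def)
    show "F x (z i) = 0" if "i < p" for i
      using \<psi>[of "Inr i"] that by simp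
  qed
  with pos[of i x, OF x(2,3)] show False by simp
qed

text \<open>The \<open>n\<close> coordinates count as the first forms, so this corresponds to
  \<open>energy\<close> at step \<open>n + t\<close>.\<close>

definition form_energy ::
  "nat \<Rightarrow> (nat \<Rightarrow> (nat \<Rightarrow> complex) \<Rightarrow> complex) \<Rightarrow> nat \<Rightarrow> (nat \<Rightarrow> complex) \<Rightarrow> real" where
  "form_energy n w t x = sqnorm n x + (\<Sum>s<t. (cmod (w s x))\<^sup>2)"

text \<open>The determinant bound for forms restricted to the span of \<open>e\<close>, written in
  the coordinates \<open>c\<close>; \<open>m\<close> is the dimension of that span.\<close>

lemma form_energy_growth:
  fixes e :: "nat \<Rightarrow> nat \<Rightarrow> complex" and m :: nat
  defines "x \<equiv> \<lambda>c i. \<Sum>l<m. c l * e l i"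
  assumes w: "\<And>t. t < S \<Longrightarrow> linear_form (w t)"
    and indep: "\<And>c. \<exists>l<m. c l \<noteq> 0 \<Longrightarrow> 0 < sqnorm n (x c)"
    and s: "0 \<le> s" and \<kappa>: "\<And>t. 0 \<le> \<kappa> t"
    and step: "\<And>t c. t < S \<Longrightarrow> (cmod (w t (x c)))\<^sup>2 \<le> \<kappa> t * form_energy n w t (x c)"
    and growth: "\<And>c. s * sqnorm n (x c) \<le> form_energy n w S (x c)"
  shows "s ^ m \<le> (\<Prod>t<S. 1 + \<kappa> t)"
proof -
  \<comment> \<open>The first \<open>n\<close> vectors represent the coordinates and the next
    \<open>S\<close> the forms; later ones are filled up with 0 because \<open>v\<close> is a total
    function.\<close>
  define v where "v i = vec m (\<lambda>l. if i < n then e l i else if i < n + S then w (i - n) (e l) else 0)" for i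
  define y where "y c = x (\<lambda>l. c $ l)" for c :: "complex vec"
  have v1: "v i \<bullet> c = y c i" if "i < n" "c \<in> carrier_vec m" for i c
    using that by (simp add: v_def y_def x_def scalar_prod_def atLeast0LessThan mult.commute)
  have v2: "v (n + t) \<bullet> c = w t (y c)" if "t < S" "c \<in> carrier_vec m" for t c
    using that unfolding y_def x_def linear_form_sum[OF w[OF that(1)]]
    by (simp add: v_def scalar_prod_def atLeast0LessThan mult.commute)
  have en: "energy v n c = sqnorm n (y c)" if "c \<in> carrier_vec m" for c
    using that by (simp add: energy_def sqnorm_def v1)
  have et: "energy v (n + t) c = form_energy n w t (y c)" if "t \<le> S" "c \<in> carrier_vec m" for t c
    using that
  proof (induction t)
    case (Suc t)
    have "energy v (n + Suc t) c = energy v (n + t) c + (cmod (v (n + t) \<bullet> c))\<^sup>2"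
      by (simp add: energy_def)
    then show ?case using Suc by (simp add: form_energy_def v2)
  qed (simp add: en form_energy_def)
  have "s ^ m \<le> (\<Prod>t\<in>{n..<n + S}. 1 + \<kappa> (t - n))"
  proof (rule energy_growth[of v])
    fix c :: "complex vec" assume c: "c \<in> carrier_vec m"
    show "s * energy v n c \<le> energy v (n + S) c"
      using c growth by (simp add: en et y_def)
    show "0 < energy v n c" if "c \<noteq> 0\<^sub>v m"
    proof -
      have "\<exists>l<m. c $ l \<noteq> 0"
      proof (rule ccontr)
        assume "\<not> ?thesis"
        then have "c = 0\<^sub>v m" using c by (intro eq_vecI) auto
        with that show False by simp
      qed
      then show ?thesis using indep[of "\<lambda>l. c $ l"] c by (simp add: en y_def)
    qed
    fix t assume t: "n \<le> t" "t < n + S"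
    obtain u where u: "t = n + u" "u < S" using t le_Suc_ex by force
    show "(cmod (v t \<bullet> c))\<^sup>2 \<le> \<kappa> (t - n) * energy v t c"
      using step[OF u(2)] u c by (simp add: v2 et y_def)
  qed (auto simp: v_def \<kappa> s)
  also have "\<dots> = (\<Prod>t<S. 1 + \<kappa> t)"
    by (rule prod.reindex_bij_witness[of _ "\<lambda>t. n + t" "\<lambda>t. t - n"]) auto
  finally show ?thesis .
qed

text \<open>Linear independence without definiteness: \<open>F\<close> takes the value
  \<open>sqnorm m c\<close>, which is positive, at the combination, so the combination is not
  0.\<close>

lemma orthonormal_sqnorm_pos:
  assumes F: "hermitian F" and z: "orthonormal F m z"
    and supp: "\<And>l i. l < m \<Longrightarrow> n \<le> i \<Longrightarrow> z l i = 0"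
    and c: "\<exists>l<m. c l \<noteq> 0"
  shows "0 < sqnorm n (\<lambda>i. \<Sum>l<m. c l * z l i)"
proof -
  let ?x = "\<lambda>i. \<Sum>l<m. c l * z l i"
  have "F ?x ?x = of_real (sqnorm m c)"
    by (simp only: orthonormal_form[OF F z] sqnorm_def of_real_sum complex_norm_square)
  moreover have "0 < sqnorm m c"
    using c sqnorm_pos by blast
  ultimately have "F ?x ?x \<noteq> 0" by simp
  moreover have "F (\<lambda>i. 0) y = 0" for y
    by (rule linear_form_zero[OF hermitian_linear[OF F]])
  ultimately have "?x \<noteq> (\<lambda>i. 0)" by metis
  then obtain i where "?x i \<noteq> 0" by blast
  moreover have "?x i = 0" if "n \<le> i"
    using supp that by (simp add: sum.neutral)
  ultimately have "sqnorm n ?x \<noteq> 0"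
    using sqnorm_pos[of i n ?x] by force
  then show ?thesis using sqnorm_nonneg[of n ?x] by simp
qed

text \<open>Signs that maximize the quadratic form of \<open>B\<close> work, because flipping a single sign does
  not increase its value.\<close>

lemma sign_choice:
  fixes B :: "nat \<Rightarrow> nat \<Rightarrow> real"
  assumes sym: "\<And>j k. B j k = B k j"
  shows "\<exists>\<epsilon>. (\<forall>j<n. \<bar>\<epsilon> j\<bar> = 1) \<and> (\<forall>k<n. B k k \<le> \<epsilon> k * (\<Sum>j<n. \<epsilon> j * B j k))"
proof -
  define E where "E = PiE {..<n} (\<lambda>_. {1, -1 :: real})"
  define q where "q \<epsilon> = (\<Sum>j<n. \<Sum>k<n. \<epsilon> j * \<epsilon> k * B j k)" for \<epsilon>
  have E: "finite E" by (auto simp: E_def intro: finite_PiE)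
  moreover have "restrict (\<lambda>_. 1) {..<n} \<in> E" by (simp add: E_def)
  ultimately have "Max (q ` E) \<in> q ` E" by (intro Max_in) auto
  then obtain \<epsilon> where \<epsilon>: "\<epsilon> \<in> E" "q \<epsilon> = Max (q ` E)" by auto
  have max: "q \<epsilon>' \<le> q \<epsilon>" if "\<epsilon>' \<in> E" for \<epsilon>'
    using that E by (simp add: \<epsilon>(2))
  have sgn: "\<epsilon> j = 1 \<or> \<epsilon> j = -1" if "j < n" for j
    using \<epsilon>(1) that by (auto simp: E_def PiE_iff)
  have "B k k \<le> \<epsilon> k * (\<Sum>j<n. \<epsilon> j * B j k)" if k: "k < n" for k
  proof -
    \<comment> \<open>Flipping sign \<open>k\<close> subtracts \<open>d\<close>. This changes the
      quadratic form by 4 times the difference of \<open>B k k\<close> and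
      \<open>\<epsilon> k * (\<Sum>j<n. \<epsilon> j * B j k)\<close>, which maximality makes
      nonpositive.\<close>
    define d where "d j = (if j = k then 2 * \<epsilon> k else 0)" for j
    let ?\<epsilon>' = "\<epsilon>(k := - \<epsilon> k)"
    have "?\<epsilon>' \<in> E" using \<epsilon>(1) k sgn[OF k] by (auto simp: E_def PiE_iff extensional_def)
    have \<epsilon>': "?\<epsilon>' j = \<epsilon> j - d j" for j by (simp add: d_def)
    have dsum: "(\<Sum>j<n. d j * g j) = 2 * \<epsilon> k * g k" for g
      using k by (simp add: d_def if_distrib[of "\<lambda>x. x * _"] cong: if_cong)
    have "q ?\<epsilon>' = q \<epsilon> - (\<Sum>j<n. d j * (\<Sum>l<n. \<epsilon> l * B j l)) - (\<Sum>j<n. \<epsilon> j * (\<Sum>l<n. d l * B j l))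
        + (\<Sum>j<n. d j * (\<Sum>l<n. d l * B j l))"
      unfolding q_def \<epsilon>' sum_distrib_left
      by (simp add: algebra_simps sum.distrib sum_subtractf)
    also have "\<dots> = q \<epsilon> - 4 * \<epsilon> k * (\<Sum>j<n. \<epsilon> j * B j k) + 4 * B k k"
    proof -
      have "(\<Sum>l<n. \<epsilon> l * B k l) = (\<Sum>j<n. \<epsilon> j * B j k)"
        by (simp add: sym[of k])
      moreover have "(\<Sum>j<n. \<epsilon> j * (2 * \<epsilon> k * B j k)) = 2 * \<epsilon> k * (\<Sum>j<n. \<epsilon> j * B j k)"
        by (simp add: sum_distrib_left mult_ac)
      moreover have "\<epsilon> k * \<epsilon> k = 1" using sgn[OF k] by auto
      then have "2 * \<epsilon> k * (2 * \<epsilon> k * B k k) = 4 * B k k"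
        by (metis (no_types, lifting) mult.assoc mult.commute mult.left_neutral mult_2 numeral_Bit0 numeral_plus_numeral distrib_right)
      ultimately show ?thesis by (simp add: dsum)
    qed
    finally show ?thesis using max[OF \<open>?\<epsilon>' \<in> E\<close>] by simp
  qed
  moreover have "\<bar>\<epsilon> j\<bar> = 1" if "j < n" for j
    using sgn[OF that] by auto
  ultimately show ?thesis by blast
qed

text \<open>With respect to the Hermitian form \<open>G\<close>, which weighs the \<open>f i\<close> by \<open>\<kappa>\<close>, each
  \<open>lam k\<close> has a Riesz representative in \<open>U\<close>; the vector \<open>u\<close> is a signed sum of these, and
  \<open>\<rho> k\<close> are their squared \<open>G\<close>-norms.\<close>

lemma ex_large_values:
  fixes \<kappa> \<delta> M :: real and n N :: nat and I :: "'i set"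
    and \<phi> :: "'i \<Rightarrow> (nat \<Rightarrow> complex) \<Rightarrow> complex"
  defines "U \<equiv> zero_space n I \<phi>"
  assumes lam: "\<And>k. k < n \<Longrightarrow> linear_form (lam k)" and f: "\<And>i. i < N \<Longrightarrow> linear_form (f i)"
    and I: "finite I" and \<phi>: "\<And>j. j \<in> I \<Longrightarrow> linear_form (\<phi> j)"
    and parseval: "\<And>x. (\<Sum>k<n. (cmod (lam k x))\<^sup>2) = sqnorm n x"
    and bound: "\<And>x i. x \<in> U \<Longrightarrow> i < N \<Longrightarrow> (cmod (f i x))\<^sup>2 \<le> M * sqnorm n x"
    and nonneg: "0 \<le> \<kappa>" "0 \<le> \<delta>" "0 \<le> M"
  shows "\<exists>u\<in>U. \<kappa> * (\<Sum>i<N. (cmod (f i u))\<^sup>2) \<le> n \<and>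
           real n - card I - \<kappa> * N * M - \<delta> * n \<le> card {k. k < n \<and> \<delta> \<le> cmod (lam k u)}"
proof -
  let ?d = "n - card I"
  let ?Q = "\<lambda>x. \<Sum>i<N. (cmod (f i x))\<^sup>2"
  define G where "G x y = (\<Sum>i<n. x i * cnj (y i)) + of_real \<kappa> * (\<Sum>i<N. f i x * cnj (f i y))" for x y
  have Gxx: "G x x = of_real (sqnorm n x + \<kappa> * ?Q x)" for x
    by (simp only: G_def sqnorm_def of_real_add of_real_mult of_real_sum complex_norm_square)
  have G: "hermitian G"
    unfolding hermitian_def linear_form_def G_def
    by (auto simp: linear_form_add[OF f] linear_form_scale[OF f] algebra_simps sum.distrib sum_distrib_left)
  have Qnn: "0 \<le> ?Q x" for x by (simp add: sum_nonneg)
  have sq_le: "sqnorm n x \<le> Re (G x x)" for x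
    using nonneg Qnn[of x] by (simp add: Gxx)
  obtain e where e: "\<And>l. l < ?d \<Longrightarrow> e l \<in> U" "orthonormal G ?d e"
    using zero_space_orthonormal[of G n I \<phi>] G I \<phi> sqnorm_pos sq_le unfolding U_def
    by (metis (no_types, lifting) order_less_le_trans)
  have comb: "(\<lambda>i. \<Sum>l<?d. c l * e l i) \<in> U" for c
    unfolding U_def by (rule zero_space_sum) (use e(1) \<phi> in \<open>auto simp: U_def\<close>)
  \<comment> \<open>\<open>?y\<close> is the Riesz representative of \<open>\<psi>\<close> in the
    span of \<open>e\<close>. Both \<open>\<psi> ?y\<close> and \<open>G ?y ?y\<close> equal
    \<open>?R\<close>, so the bound on \<open>\<psi>\<close> at \<open>?y\<close> reads
    \<open>?R\<^sup>2 \<le> B * ?R\<close>.\<close>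
  have riesz: "(\<Sum>l<?d. (cmod (\<psi> (e l)))\<^sup>2) \<le> B"
    if \<psi>: "linear_form \<psi>" "\<And>x. x \<in> U \<Longrightarrow> (cmod (\<psi> x))\<^sup>2 \<le> B * sqnorm n x" and B: "0 \<le> B" for \<psi> B
  proof -
    let ?y = "\<lambda>i. \<Sum>l<?d. cnj (\<psi> (e l)) * e l i"
    let ?R = "\<Sum>l<?d. (cmod (\<psi> (e l)))\<^sup>2"
    have R: "complex_of_real ?R = (\<Sum>l<?d. cnj (\<psi> (e l)) * \<psi> (e l))"
      by (simp only: of_real_sum complex_norm_square mult.commute)
    have \<psi>y: "\<psi> ?y = of_real ?R"
      unfolding R by (rule linear_form_sum[OF \<psi>(1)])
    have Gy: "G ?y ?y = of_real ?R"
      unfolding R orthonormal_form[OF G e(2)] by simp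
    have "0 \<le> ?R" by (simp add: sum_nonneg)
    have "?R\<^sup>2 = (cmod (\<psi> ?y))\<^sup>2"
      unfolding \<psi>y norm_of_real power2_abs ..
    also have "\<dots> \<le> B * sqnorm n ?y"
      by (rule \<psi>(2)[OF comb])
    also have "\<dots> \<le> B * ?R"
      using sq_le[of ?y] B unfolding Gy Re_complex_of_real by (rule mult_left_mono)
    finally have "?R * ?R \<le> B * ?R" by (simp only: power2_eq_square)
    then show ?thesis
      using B \<open>0 \<le> ?R\<close> by (cases "?R = 0") (auto dest: mult_right_le_imp_le)
  qed
  define \<rho> where "\<rho> k = (\<Sum>l<?d. (cmod (lam k (e l)))\<^sup>2)" for k
  have \<rho>1: "\<rho> k \<le> 1" if k: "k < n" for k
    unfolding \<rho>_def
  proof (rule riesz[OF lam[OF k]])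
    show "(cmod (lam k x))\<^sup>2 \<le> 1 * sqnorm n x" for x
      unfolding parseval[symmetric] mult_1_left using k by (intro member_le_sum) auto
  qed simp
  \<comment> \<open>By Parseval the \<open>\<rho> k\<close> add up to the squared norms of the
    \<open>e l\<close>. Each of these is 1 minus the weighted contribution of the
    \<open>f i\<close>, and by \<open>riesz\<close> every \<open>f i\<close> contributes at most
    \<open>M\<close> over all \<open>l\<close>.\<close>
  have "real ?d - \<kappa> * N * M \<le> (\<Sum>k<n. \<rho> k)"
  proof -
    have "(\<Sum>l<?d. ?Q (e l)) = (\<Sum>i<N. \<Sum>l<?d. (cmod (f i (e l)))\<^sup>2)"
      by (rule sum.swap)
    also have "\<dots> \<le> (\<Sum>i<N. M)"
      by (intro sum_mono riesz f bound nonneg) auto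
    finally have Q: "\<kappa> * (\<Sum>l<?d. ?Q (e l)) \<le> \<kappa> * (N * M)"
      using nonneg by (intro mult_left_mono) auto
    have "(\<Sum>k<n. \<rho> k) = (\<Sum>l<?d. sqnorm n (e l))"
      unfolding \<rho>_def by (subst sum.swap) (simp add: parseval)
    also have "\<dots> = (\<Sum>l<?d. 1 - \<kappa> * ?Q (e l))"
    proof (intro sum.cong refl)
      fix l assume "l \<in> {..<?d}"
      then have "G (e l) (e l) = 1" using e(2) by (auto simp: orthonormal_def)
      then have "sqnorm n (e l) + \<kappa> * ?Q (e l) = 1"
        unfolding Gxx by (metis of_real_eq_1_iff)
      then show "sqnorm n (e l) = 1 - \<kappa> * ?Q (e l)" by simp
    qed
    also have "\<dots> = real ?d - \<kappa> * (\<Sum>l<?d. ?Q (e l))"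
      by (simp add: sum_subtractf sum_distrib_left)
    finally show ?thesis using Q by (simp add: mult.assoc)
  qed
  moreover have "real n - card I \<le> real ?d" by simp
  ultimately have trace: "real n - card I - \<kappa> * N * M \<le> (\<Sum>k<n. \<rho> k)" by linarith
  \<comment> \<open>The real part of the Gram matrix of the Riesz representatives, to which the sign
    choice is applied.\<close>
  define B where "B j k = Re (\<Sum>l<?d. lam j (e l) * cnj (lam k (e l)))" for j k
  have Bsym: "B j k = B k j" for j k
    unfolding B_def Re_sum by (intro sum.cong refl) (simp add: mult.commute)
  have Bkk: "B k k = \<rho> k" for k
    unfolding B_def \<rho>_def Re_sum by (intro sum.cong refl) (metis complex_norm_square Re_complex_of_real)
  obtain \<epsilon> where \<epsilon>: "\<And>j. j < n \<Longrightarrow> \<bar>\<epsilon> j\<bar> = 1"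
    "\<And>k. k < n \<Longrightarrow> B k k \<le> \<epsilon> k * (\<Sum>j<n. \<epsilon> j * B j k)"
    using sign_choice[of B n] Bsym by metis
  define c where "c l = (\<Sum>j<n. of_real (\<epsilon> j) * cnj (lam j (e l)))" for l
  define u where "u = (\<lambda>i. \<Sum>l<?d. c l * e l i)"
  have uU: "u \<in> U" unfolding u_def by (rule comb)
  have lamu: "lam k u = (\<Sum>l<?d. c l * lam k (e l))" if "k < n" for k
    unfolding u_def by (rule linear_form_sum[OF lam[OF that]])
  have \<rho>_le: "\<rho> k \<le> cmod (lam k u)" if k: "k < n" for k
  proof -
    have "lam k u = (\<Sum>j<n. of_real (\<epsilon> j) * (\<Sum>l<?d. lam k (e l) * cnj (lam j (e l))))"
      unfolding lamu[OF k] c_def sum_distrib_left sum_distrib_right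
      by (subst sum.swap) (simp add: mult_ac)
    then have "Re (lam k u) = (\<Sum>j<n. \<epsilon> j * B k j)"
      by (simp add: B_def)
    then have "\<rho> k \<le> \<epsilon> k * Re (lam k u)"
      using \<epsilon>(2)[OF k] by (simp add: Bkk Bsym[of k])
    also have "\<dots> \<le> \<bar>\<epsilon> k\<bar> * \<bar>Re (lam k u)\<bar>" by (metis abs_ge_self abs_mult)
    also have "\<dots> \<le> cmod (lam k u)" using \<epsilon>(1)[OF k] by (simp add: abs_Re_le_cmod)
    finally show ?thesis .
  qed
  \<comment> \<open>By the choice of \<open>c\<close>, \<open>G u u\<close> is the signed sum of the
    \<open>lam j u\<close>. It is at most \<open>n / 2 + sqnorm n u / 2\<close>, and the second term
    is absorbed because \<open>sqnorm n u\<close> is at most \<open>G u u\<close>.\<close>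
  have "G u u = (\<Sum>l<?d. c l * cnj (c l))"
    unfolding u_def by (rule orthonormal_form[OF G e(2)])
  also have "\<dots> = (\<Sum>l<?d. \<Sum>j<n. of_real (\<epsilon> j) * (c l * lam j (e l)))"
    by (intro sum.cong refl) (subst (2) c_def, simp add: sum_distrib_left mult_ac)
  also have "\<dots> = (\<Sum>j<n. of_real (\<epsilon> j) * lam j u)"
    by (subst sum.swap) (simp add: lamu sum_distrib_left)
  finally have "Re (G u u) = (\<Sum>j<n. \<epsilon> j * Re (lam j u))" by simp
  also have "\<dots> \<le> (\<Sum>j<n. 1 / 2 + (cmod (lam j u))\<^sup>2 / 2)"
  proof (rule sum_mono)
    fix j assume "j \<in> {..<n}"
    then have "\<epsilon> j * Re (lam j u) \<le> cmod (lam j u)"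
      using \<epsilon>(1)[of j] abs_Re_le_cmod[of "lam j u"]
      by (metis abs_ge_self abs_mult lessThan_iff mult_1_left order_trans)
    also have "\<dots> \<le> 1 / 2 + (cmod (lam j u))\<^sup>2 / 2"
      using sum_squares_bound[of 1 "cmod (lam j u)"] by simp
    finally show "\<epsilon> j * Re (lam j u) \<le> 1 / 2 + (cmod (lam j u))\<^sup>2 / 2" .
  qed
  also have "\<dots> = n / 2 + sqnorm n u / 2"
    by (simp add: sum.distrib flip: sum_divide_distrib parseval)
  finally have "Re (G u u) \<le> n" using sq_le[of u] by simp
  then have "\<kappa> * ?Q u \<le> n"
    using sqnorm_nonneg[of n u] by (simp add: Gxx)
  moreover have "real n - card I - \<kappa> * N * M - \<delta> * n \<le> card {k. k < n \<and> \<delta> \<le> cmod (lam k u)}"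
  proof -
    let ?K = "{k. k < n \<and> \<delta> \<le> cmod (lam k u)}"
    \<comment> \<open>Indices in \<open>?K\<close> contribute at most 1 each, the others less than
      \<open>\<delta>\<close> because \<open>\<rho> k\<close> is at most the modulus of
      \<open>lam k u\<close>.\<close>
    have "(\<Sum>k<n. \<rho> k) \<le> (\<Sum>k<n. (if k \<in> ?K then 1 else 0) + \<delta>)"
    proof (rule sum_mono)
      fix k assume "k \<in> {..<n}"
      then show "\<rho> k \<le> (if k \<in> ?K then 1 else 0) + \<delta>"
        using \<rho>1[of k] \<rho>_le[of k] nonneg by auto
    qed
    also have "\<dots> = card ?K + \<delta> * n"
    proof -
      have "{..<n} \<inter> {k. \<delta> \<le> cmod (lam k u)} = ?K" by auto
      then show ?thesis by (simp add: sum.distrib sum.If_cases)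
    qed
    finally show ?thesis using trace by simp
  qed
  ultimately show ?thesis using uU by blast
qed

section \<open>Fourier transform and circuit evaluation\<close>

text \<open>The factor \<open>1 / sqrt n\<close> makes the transform unitary; convolution then picks
  up a factor \<open>sqrt n\<close>.\<close>

definition dft :: "nat \<Rightarrow> nat \<Rightarrow> (nat \<Rightarrow> complex) \<Rightarrow> complex" where
  "dft n k x = (\<Sum>i<n. x i * cis (2 * pi * real k / real n) ^ i) / of_real (sqrt n)"

lemma linear_form_dft: "linear_form (dft n k)"
  by (auto simp: linear_form_def dft_def algebra_simps sum.distrib add_divide_distrib
      sum_distrib_left simp flip: sum_divide_distrib)

lemma sum_root_of_unity_powers:
  fixes z :: complex
  assumes "z ^ n = 1" "z \<noteq> 1"
  shows "(\<Sum>k<n. z ^ k) = 0"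
  using assms by (simp add: geometric_sum)

lemma cis_power_swap:
  "cis (2 * pi * real k / real n) ^ i = cis (2 * pi * real i / real n) ^ k"
  by (simp add: DeMoivre mult_ac)

text \<open>Exchanging the roles of index and exponent gives a geometric sum of powers of an
  \<open>n\<close>-th root of unity, which differs from 1 if \<open>i \<noteq> j\<close>.\<close>

lemma sum_characters:
  assumes "i < n" "j < n"
  shows "(\<Sum>k<n. cis (2 * pi * real k / real n) ^ i * cnj (cis (2 * pi * real k / real n) ^ j))
       = (if i = j then of_nat n else 0)"
proof -
  let ?r = "\<lambda>i. cis (2 * pi * real i / real n)"
  let ?z = "?r i * cnj (?r j)"
  have eq: "(\<Sum>k<n. ?r k ^ i * cnj (?r k ^ j)) = (\<Sum>k<n. ?z ^ k)"
    unfolding cis_power_swap[of _ n i] cis_power_swap[of _ n j]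
    by (simp add: power_mult_distrib)
  have bij: "bij_betw ?r {..<n} {z. z ^ n = 1}"
    using bij_betw_roots_unity[of n] assms by simp
  have r1: "?r i ^ n = 1" for i
    using assms by (simp add: DeMoivre)
  have unit: "?r i * cnj (?r i) = 1" for i
    by (simp add: cis_cnj cis_mult)
  show ?thesis
  proof (cases "i = j")
    case True
    then show ?thesis unfolding eq using unit by simp
  next
    case False
    then have "?r i \<noteq> ?r j"
      using bij assms by (auto simp: bij_betw_def inj_on_def)
    moreover have "?r i = ?z * ?r j"
      using unit[of j] by (metis mult.assoc mult.commute mult_1_right)
    ultimately have "?z \<noteq> 1" by (metis mult_1_left)
    moreover have "?z ^ n = 1"
      by (simp add: power_mult_distrib r1 flip: complex_cnj_power)
    ultimately show ?thesis
      unfolding eq using False by (simp add: sum_root_of_unity_powers)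
  qed
qed

lemma parseval: "(\<Sum>k<n. (cmod (dft n k x))\<^sup>2) = sqnorm n x"
proof (cases "n = 0")
  case False
  let ?r = "\<lambda>k. cis (2 * pi * real k / real n)"
  have sq: "complex_of_real (sqrt n) * of_real (sqrt n) = of_nat n"
    by (simp flip: of_real_mult)
  have "complex_of_real (\<Sum>k<n. (cmod (dft n k x))\<^sup>2) = (\<Sum>k<n. dft n k x * cnj (dft n k x))"
    by (simp only: of_real_sum complex_norm_square)
  also have "\<dots> = (\<Sum>k<n. (\<Sum>i<n. \<Sum>j<n. x i * cnj (x j) * (?r k ^ i * cnj (?r k ^ j))) / of_nat n)"
    unfolding dft_def
    by (intro sum.cong refl) (simp add: sq sum_product mult_ac)
  also have "\<dots> = (\<Sum>k<n. \<Sum>i<n. \<Sum>j<n. x i * cnj (x j) * (?r k ^ i * cnj (?r k ^ j))) / of_nat n"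
    by (simp only: sum_divide_distrib)
  also have "(\<Sum>k<n. \<Sum>i<n. \<Sum>j<n. x i * cnj (x j) * (?r k ^ i * cnj (?r k ^ j)))
      = (\<Sum>i<n. \<Sum>j<n. x i * cnj (x j) * (\<Sum>k<n. ?r k ^ i * cnj (?r k ^ j)))"
    unfolding sum_distrib_left
    by (rule trans[OF sum.swap]) (rule sum.cong[OF refl], rule sum.swap)
  also have "\<dots> = (\<Sum>i<n. \<Sum>j<n. if j = i then x i * cnj (x i) * of_nat n else 0)"
    by (intro sum.cong refl) (subst sum_characters, auto)
  also have "\<dots> = (\<Sum>i<n. x i * cnj (x i)) * of_nat n"
    by (simp add: sum_distrib_right)
  also have "\<dots> / of_nat n = (\<Sum>i<n. x i * cnj (x i))"
    using False by simp
  also have "\<dots> = of_real (sqnorm n x)"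
    by (simp only: sqnorm_def of_real_sum complex_norm_square)
  finally show ?thesis by (simp only: of_real_eq_iff)
qed (simp add: sqnorm_def)

text \<open>Powers of an \<open>n\<close>-th root of unity depend only on the exponent modulo
  \<open>n\<close>, so the sum over the residue classes becomes a full double sum, which
  factors.\<close>

lemma dft_conv:
  assumes "k < n"
  shows "dft n k (conv n a b) = of_real (sqrt n) * dft n k a * dft n k b"
proof -
  let ?w = "cis (2 * pi * real k / real n)"
  have w1: "?w ^ n = 1" using assms by (simp add: DeMoivre)
  have w: "?w ^ (m mod n) = ?w ^ m" for m
  proof -
    have "?w ^ m = ?w ^ (n * (m div n) + m mod n)" by simp
    also have "\<dots> = ?w ^ (m mod n)" unfolding power_add power_mult w1 by simp
    finally show ?thesis ..
  qed
  let ?P = "{..<n} \<times> {..<n}"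
  have conv: "conv n a b m = (\<Sum>(i, j)\<in>?P. if (i + j) mod n = m then a i * b j else 0)" if "m < n" for m
  proof -
    have "{(i, j). i < n \<and> j < n \<and> (i + j) mod n = m mod n} = {p \<in> ?P. (fst p + snd p) mod n = m}"
      using that by auto
    then show ?thesis
      unfolding conv_def case_prod_beta by (simp add: sum.inter_filter)
  qed
  have "(\<Sum>m<n. conv n a b m * ?w ^ m)
      = (\<Sum>m<n. \<Sum>p\<in>?P. if (fst p + snd p) mod n = m then a (fst p) * b (snd p) * ?w ^ m else 0)"
    by (intro sum.cong refl) (auto simp: conv sum_distrib_right case_prod_beta intro!: sum.cong)
  also have "\<dots> = (\<Sum>p\<in>?P. a (fst p) * b (snd p) * ?w ^ (fst p + snd p))"
    using assms by (subst sum.swap) (simp add: w)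
  also have "\<dots> = (\<Sum>i<n. a i * ?w ^ i) * (\<Sum>j<n. b j * ?w ^ j)"
    unfolding sum_product sum.cartesian_product by (simp add: case_prod_beta power_add mult_ac)
  finally have "dft n k (conv n a b) = (\<Sum>i<n. a i * ?w ^ i) * (\<Sum>j<n. b j * ?w ^ j) / of_real (sqrt n)"
    by (simp add: dft_def)
  then show ?thesis using assms by (simp add: dft_def)
qed

text \<open>Convolution with a fixed \<open>a\<close> is diagonal in the Fourier basis, so large
  coefficients of \<open>a\<close> force expansion.\<close>

lemma sqnorm_conv:
  "sqnorm n (conv n a b) = (\<Sum>k<n. n * (cmod (dft n k a))\<^sup>2 * (cmod (dft n k b))\<^sup>2)"
  unfolding parseval[symmetric, of _ "conv n a b"]
  by (intro sum.cong refl) (simp add: dft_conv norm_mult power_mult_distrib)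

section \<open>Evaluation of circuits\<close>

lemma run_snoc: "run a b (C @ [g]) = run a b C @ [instr_val a b (run a b C) g]"
  by (simp add: run_def)

lemma length_run [simp]: "length (run a b C) = length C"
  by (induction C rule: rev_induct) (simp_all add: run_snoc, simp add: run_def)

lemma run_append_nth: "t < length C \<Longrightarrow> run a b (C @ D) ! t = run a b C ! t"
proof (induction D rule: rev_induct)
  case (snoc g D)
  then show ?case
    unfolding append_assoc[symmetric] run_snoc by (simp add: nth_append)
qed simp

lemma instr_val_cong:
  assumes "\<And>u. u \<in> operands g \<Longrightarrow> operand_val a b rs u = operand_val a' b' rs' u"
  shows "instr_val a b rs g = instr_val a' b' rs' g"
  using assms by (cases g) auto

text \<open>An instruction is evaluated on the results before it. The final list agrees with these
  at all earlier positions, so it can replace them in recursive equations.\<close>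

lemma run_nth:
  assumes t: "t < length C" and earlier: "\<And>s. Res s \<in> operands (C ! t) \<Longrightarrow> s < t"
  shows "run a b C ! t = instr_val a b (run a b C) (C ! t)"
proof -
  have prefix: "run a b C ! s = run a b (take k C) ! s" if "s < k" "k \<le> length C" for s k
    using run_append_nth[of s "take k C" a b "drop k C"] that by simp
  have "run a b C ! t = run a b (take t C @ [C ! t]) ! t"
    using prefix[of t "Suc t"] t by (simp add: take_Suc_conv_app_nth)
  also have "\<dots> = instr_val a b (run a b (take t C)) (C ! t)"
    using t by (simp add: run_snoc nth_append)
  also have "\<dots> = instr_val a b (run a b C) (C ! t)"
  proof (rule instr_val_cong)
    fix u assume "u \<in> operands (C ! t)"
    then show "operand_val a b (run a b (take t C)) u = operand_val a b (run a b C) u"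
      using earlier prefix[of _ t] t by (cases u) auto
  qed
  finally show ?thesis .
qed

lemma linear_form_instr_val:
  assumes "linear_instr g" and "\<And>u. u \<in> operands g \<Longrightarrow> linear_form (\<lambda>x. operand_val (A x) (B x) (rs x) u)"
  shows "linear_form (\<lambda>x. instr_val (A x) (B x) (rs x) g)"
  using assms by (cases g) (auto simp: linear_form_def algebra_simps)

text \<open>The constant 4 covers both a scalar of modulus at most 2 and a sum or difference, where
  the squared modulus is at most twice the sum of the two squares.\<close>

lemma instr_val_bound:
  assumes "linear_instr g" "\<not> help_gate g"
    and E: "\<And>u. u \<in> operands g \<Longrightarrow> (cmod (operand_val a b rs u))\<^sup>2 \<le> E"
  shows "(cmod (instr_val a b rs g))\<^sup>2 \<le> 4 * E"
proof -
  have two: "(cmod z)\<^sup>2 \<le> 4 * E"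
    if "cmod z \<le> cmod x + cmod y" "(cmod x)\<^sup>2 \<le> E" "(cmod y)\<^sup>2 \<le> E" for x y z
  proof -
    have "(cmod z)\<^sup>2 \<le> (cmod x + cmod y)\<^sup>2"
      using that by (intro power_mono) auto
    also have "\<dots> \<le> 2 * ((cmod x)\<^sup>2 + (cmod y)\<^sup>2)"
      using sum_squares_bound[of "cmod x" "cmod y"] by (simp add: power2_sum)
    finally show ?thesis using that by simp
  qed
  show ?thesis
  proof (cases g)
    case (Add u v)
    then show ?thesis using E by (auto intro!: two norm_triangle_ineq)
  next
    case (Sub u v)
    then show ?thesis using E by (auto intro!: two norm_triangle_ineq4)
  next
    case (Scale c u)
    have "(cmod c)\<^sup>2 \<le> 2\<^sup>2" using assms(2) Scale by (intro power_mono) auto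
    then have "(cmod c)\<^sup>2 * (cmod (operand_val a b rs u))\<^sup>2 \<le> 4 * E"
      using E[of u] Scale by (intro mult_mono) auto
    then show ?thesis using Scale by (simp add: norm_mult power_mult_distrib)
  qed (use assms in auto)
qed

section \<open>Bilinear circuits\<close>

text \<open>The four parts are described by positions in the whole sequence, \<open>s1\<close>,
  \<open>s2\<close> and \<open>s3\<close> being the ends of the first three, so that no index has to
  be shifted.\<close>

locale bilinear_parts =
  fixes n :: nat and C :: "instr list" and s1 s2 s3 :: nat
  assumes parts: "s1 \<le> s2" "s2 \<le> s3" "s3 \<le> length C"
    and part1: "\<And>t. t < s1 \<Longrightarrow> linear_instr (C ! t) \<and> operands (C ! t) \<subseteq> X ` {..<n} \<union> Res ` {..<t}"
    and part2: "\<And>t. s1 \<le> t \<Longrightarrow> t < s2 \<Longrightarrow>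
      linear_instr (C ! t) \<and> operands (C ! t) \<subseteq> Y ` {..<n} \<union> Res ` {s1..<t}"
    and part3: "\<And>t. s2 \<le> t \<Longrightarrow> t < s3 \<Longrightarrow>
      \<exists>u \<in> X ` {..<n} \<union> Res ` {..<s1}. \<exists>v \<in> Y ` {..<n} \<union> Res ` {s1..<s2}. C ! t = Mul u v"
    and part4: "\<And>t. s3 \<le> t \<Longrightarrow> t < length C \<Longrightarrow>
      linear_instr (C ! t) \<and> operands (C ! t) \<subseteq> Res ` {s2..<t}"

lemma bilinear_circuit_parts:
  assumes "bilinear_circuit n n C"
  shows "\<exists>s1 s2 s3. bilinear_parts n C s1 s2 s3"
proof -
  obtain p1 p2 p3 p4 where C: "C = p1 @ p2 @ p3 @ p4"
    and 1: "linear_circuit (X ` {..<n}) 0 p1"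
    and 2: "linear_circuit (Y ` {..<n}) (length p1) p2"
    and 3: "\<forall>g\<in>set p3. \<exists>u \<in> X ` {..<n} \<union> Res ` {..<length p1}.
           \<exists>v \<in> Y ` {..<n} \<union> Res ` {length p1..<length (p1 @ p2)}. g = Mul u v"
    and 4: "linear_circuit (Res ` {length (p1 @ p2)..<length (p1 @ p2 @ p3)}) (length (p1 @ p2 @ p3)) p4"
    using assms unfolding bilinear_circuit_def by blast
  let ?s1 = "length p1" and ?s2 = "length p1 + length p2" and ?s3 = "length p1 + length p2 + length p3"
  have "bilinear_parts n C ?s1 ?s2 ?s3"
  proof
    show "?s3 \<le> length C" by (simp add: C)
    show "linear_instr (C ! t) \<and> operands (C ! t) \<subseteq> X ` {..<n} \<union> Res ` {..<t}" if "t < ?s1" for t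
      using 1 that by (simp add: C nth_append linear_circuit_def circuit_def atLeast0LessThan)
    show "linear_instr (C ! t) \<and> operands (C ! t) \<subseteq> Y ` {..<n} \<union> Res ` {?s1..<t}"
      if t: "?s1 \<le> t" "t < ?s2" for t
    proof -
      have "C ! t = p2 ! (t - ?s1)" "t - ?s1 < length p2"
        using t by (auto simp: C nth_append)
      moreover have "?s1 + (t - ?s1) = t" using t by simp
      ultimately show ?thesis
        using 2 unfolding linear_circuit_def circuit_def by (metis nth_mem)
    qed
    show "\<exists>u \<in> X ` {..<n} \<union> Res ` {..<?s1}. \<exists>v \<in> Y ` {..<n} \<union> Res ` {?s1..<?s2}. C ! t = Mul u v"
      if t: "?s2 \<le> t" "t < ?s3" for t
    proof -
      have "C ! t = p3 ! (t - ?s2)" "t - ?s2 < length p3"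
        using t by (auto simp: C nth_append)
      then have "C ! t \<in> set p3" by simp
      then show ?thesis using 3 by simp
    qed
    show "linear_instr (C ! t) \<and> operands (C ! t) \<subseteq> Res ` {?s2..<t}"
      if t: "?s3 \<le> t" "t < length C" for t
    proof -
      have p: "C ! t = p4 ! (t - ?s3)" "t - ?s3 < length p4"
        using t by (auto simp: C nth_append)
      have "?s3 + (t - ?s3) = t" using t by simp
      then have "linear_instr (C ! t) \<and>
          operands (C ! t) \<subseteq> Res ` {?s2..<?s3} \<union> Res ` {?s3..<t}"
        using 4 p unfolding linear_circuit_def circuit_def
        by (metis add.assoc length_append nth_mem)
      then show ?thesis using t by fastforce
    qed
  qed simp_all
  then show ?thesis by blast
qed

section \<open>Results as linear forms in one argument, and their growth\<close>

context bilinear_parts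
begin

lemma run_eq:
  assumes t: "t < length C"
  shows "run a b C ! t = instr_val a b (run a b C) (C ! t)"
proof (rule run_nth[OF t])
  fix s assume s: "Res s \<in> operands (C ! t)"
  consider "t < s1" | "s1 \<le> t" "t < s2" | "s2 \<le> t" "t < s3" | "s3 \<le> t" by linarith
  then show "s < t"
  proof cases
    case 1
    then show ?thesis using part1[of t] s by auto
  next
    case 2
    then show ?thesis using part2[of t] s by auto
  next
    case 3
    then show ?thesis using part3[of t] s parts by auto
  next
    case 4
    then show ?thesis using part4[of t] s t by auto
  qed
qed

text \<open>Results of the first part do not depend on \<open>b\<close>, so \<open>b = 0\<close> is an arbitrary choice.\<close>

definition X_form :: "nat \<Rightarrow> (nat \<Rightarrow> complex) \<Rightarrow> complex" where
  "X_form t a = run a (\<lambda>_. 0) C ! t"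

lemma run_part1:
  assumes "t < s1"
  shows "run a b C ! t = X_form t a"
  using assms
proof (induction t rule: less_induct)
  case (less t)
  have t: "t < length C" using less.prems parts by simp
  show ?case
    unfolding X_form_def run_eq[OF t]
  proof (rule instr_val_cong)
    fix u assume "u \<in> operands (C ! t)"
    then consider i where "u = X i" | s where "u = Res s" "s < t"
      using part1[OF less.prems] by blast
    then show "operand_val a b (run a b C) u = operand_val a (\<lambda>_. 0) (run a (\<lambda>_. 0) C) u"
      using less.IH less.prems by cases (auto simp: X_form_def)
  qed
qed

lemma X_form_eq:
  "t < s1 \<Longrightarrow> X_form t a = instr_val a (\<lambda>_. 0) (run a (\<lambda>_. 0) C) (C ! t)"
  unfolding X_form_def using parts by (intro run_eq) simp

lemma linear_form_X_form:
  assumes "t < s1"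
  shows "linear_form (X_form t)"
  using assms
proof (induction t rule: less_induct)
  case (less t)
  have "X_form t = (\<lambda>a. instr_val a (\<lambda>_. 0) (run a (\<lambda>_. 0) C) (C ! t))"
    using less.prems by (simp add: X_form_eq fun_eq_iff)
  moreover have "linear_form \<dots>"
  proof (rule linear_form_instr_val)
    fix u assume "u \<in> operands (C ! t)"
    then consider i where "u = X i" | s where "u = Res s" "s < t"
      using part1[OF less.prems] by blast
    then show "linear_form (\<lambda>a. operand_val a (\<lambda>_. 0) (run a (\<lambda>_. 0) C) u)"
    proof cases
      case 1
      then show ?thesis by (simp add: linear_form_def)
    next
      case 2
      then show ?thesis using less.IH[of s] less.prems by (simp add: X_form_def[abs_def])
    qed
  qed (use part1[OF less.prems] in blast)
  ultimately show ?case by simp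
qed

text \<open>Help gates are split by the argument whose dimension they cost: those of the first part
  restrict \<open>a\<close>, while the later ones in \<open>help2\<close> are linear in
  \<open>b\<close> for fixed \<open>a\<close> and restrict \<open>b\<close>.\<close>

definition help1 :: "nat set" where
  "help1 = {t. t < s1 \<and> help_gate (C ! t)}"

definition help2 :: "nat set" where
  "help2 = {t. s1 \<le> t \<and> t < length C \<and> help_gate (C ! t)}"

lemma finite_help: "finite help1" "finite help2"
  by (simp_all add: help1_def help2_def)

lemma card_help: "card help1 + card help2 = num_help_gates C"
proof -
  have "card help1 + card help2 = card (help1 \<union> help2)"
    by (rule card_Un_disjoint[symmetric]) (auto simp: help1_def help2_def)
  also have "help1 \<union> help2 = {t. t < length C \<and> help_gate (C ! t)}"
    using parts by (auto simp: help1_def help2_def)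
  finally show ?thesis
    by (simp add: num_help_gates_def length_filter_conv_card)
qed

text \<open>Help gates vanish on this space, and the operands of any other gate are already summands
  of the energy.\<close>

lemma X_form_step:
  assumes t: "t < s1" and a: "a \<in> zero_space n help1 X_form"
  shows "(cmod (X_form t a))\<^sup>2 \<le> 4 * form_energy n X_form t a"
proof (cases "help_gate (C ! t)")
  case True
  then have "X_form t a = 0" using a t by (auto simp: zero_space_def help1_def)
  then show ?thesis by (simp add: form_energy_def sqnorm_nonneg sum_nonneg)
next
  case False
  show ?thesis
    unfolding X_form_eq[OF t]
  proof (rule instr_val_bound[OF _ False])
    fix u assume "u \<in> operands (C ! t)"
    then consider i where "u = X i" "i < n" | s where "u = Res s" "s < t"
      using part1[OF t] by blast
    then show "(cmod (operand_val a (\<lambda>_. 0) (run a (\<lambda>_. 0) C) u))\<^sup>2 \<le> form_energy n X_form t a"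
    proof cases
      case 1
      have "(cmod (a i))\<^sup>2 \<le> sqnorm n a"
        unfolding sqnorm_def using 1 by (intro member_le_sum) auto
      then show ?thesis
        unfolding form_energy_def using 1 by (simp add: add_increasing2 sum_nonneg)
    next
      case 2
      have "(cmod (X_form s a))\<^sup>2 \<le> (\<Sum>s<t. (cmod (X_form s a))\<^sup>2)"
        using 2 by (intro member_le_sum) auto
      then show ?thesis
        unfolding form_energy_def using 2 sqnorm_nonneg[of n a] by (simp add: X_form_def)
    qed
  qed (use part1[OF t] in blast)
qed

text \<open>A maximal family that is orthonormal for the energy minus \<open>M\<close> times the squared norm has
  fewer than \<open>P\<close> members by the determinant bound, and its orthogonal complement is the space.\<close>

lemma ex_small_space:
  assumes P: "5 ^ s1 < M ^ P" and M: "1 \<le> M"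
  shows "\<exists>(J :: (nat + nat) set) \<psi>. finite J \<and> card J < card help1 + P \<and>
           (\<forall>j\<in>J. linear_form (\<psi> j)) \<and>
           (\<forall>a\<in>zero_space n J \<psi>. form_energy n X_form s1 a \<le> M * sqnorm n a)"
proof -
  \<comment> \<open>The coefficient is \<open>M - 1\<close> because \<open>form_energy\<close>
    already contains \<open>sqnorm\<close> once.\<close>
  define F where "F x y = (\<Sum>t<s1. X_form t x * cnj (X_form t y)) - of_real (M - 1) * (\<Sum>i<n. x i * cnj (y i))" for x y
  have Fxx: "Re (F x x) = form_energy n X_form s1 x - M * sqnorm n x" for x
  proof -
    have "F x x = of_real (form_energy n X_form s1 x - M * sqnorm n x)"
      unfolding F_def form_energy_def sqnorm_def
      by (simp add: complex_norm_square algebra_simps del: of_real_power)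
    then show ?thesis by simp
  qed
  have X: "\<And>t. t < s1 \<Longrightarrow> linear_form (X_form t)" by (rule linear_form_X_form)
  have F: "hermitian F"
    unfolding hermitian_def linear_form_def F_def
    by (auto simp: linear_form_add[OF X] linear_form_scale[OF X] algebra_simps sum.distrib sum_distrib_left)
  let ?U = "zero_space n help1 X_form"
  have lin: "linear_form (X_form t)" if "t \<in> help1" for t
    using that X by (simp add: help1_def)
  \<comment> \<open>On the span of such a family \<open>F\<close> is nonnegative, so the energy
    grows by a factor \<open>M\<close> in \<open>P\<close> dimensions, while each of the
    \<open>s1\<close> steps contributes at most a factor \<open>1 + 4\<close>.\<close>
  have no: False if z: "\<forall>i<P. z i \<in> ?U" "orthonormal F P z" for z
  proof -
    have "M ^ P \<le> (\<Prod>t<s1. 1 + (4::real))"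
    proof (rule form_energy_growth[where w = X_form and e = z and n = n and \<kappa> = "\<lambda>_. 4"])
      show "0 < sqnorm n (\<lambda>i. \<Sum>l<P. c l * z l i)" if "\<exists>l<P. c l \<noteq> 0" for c
        by (rule orthonormal_sqnorm_pos[OF F z(2) _ that]) (use z(1) in \<open>auto simp: zero_space_def\<close>)
      fix c
      let ?x = "\<lambda>i. \<Sum>l<P. c l * z l i"
      have "?x \<in> ?U"
        by (rule zero_space_sum) (use z(1) lin in auto)
      then show "(cmod (X_form t ?x))\<^sup>2 \<le> 4 * form_energy n X_form t ?x" if "t < s1" for t
        by (rule X_form_step[OF that])
      have "Re (F ?x ?x) = sqnorm P c"
      proof -
        have "F ?x ?x = of_real (sqnorm P c)"
          by (simp only: orthonormal_form[OF F z(2)] sqnorm_def of_real_sum complex_norm_square)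
        then show ?thesis by simp
      qed
      then show "M * sqnorm n ?x \<le> form_energy n X_form s1 ?x"
        using sqnorm_nonneg[of P c] by (simp add: Fxx)
    qed (use X M in auto)
    then show False using P by simp
  qed
  have U: "(\<lambda>i. c * a i) \<in> ?U" if "a \<in> ?U" for c a
    by (rule zero_space_scale[OF lin that])
  have maximal: "(\<exists>z. (\<forall>i<P. z i \<in> ?U) \<and> orthonormal F P z) \<or>
     (\<exists>p<P. \<exists>z. (\<forall>i<p. z i \<in> ?U) \<and> orthonormal F p z \<and>
        (\<forall>x\<in>?U. (\<forall>i<p. F x (z i) = 0) \<longrightarrow> Re (F x x) \<le> 0))"
    by (rule orthonormal_or_maximal[OF F]) (rule U)
  have "\<exists>p<P. \<exists>z. \<forall>x\<in>?U. (\<forall>i<p. F x (z i) = 0) \<longrightarrow> Re (F x x) \<le> 0"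
    using maximal
  proof (elim disjE exE conjE)
    fix z assume "\<forall>i<P. z i \<in> ?U" "orthonormal F P z"
    then show ?thesis by (rule no[THEN FalseE])
  qed blast
  then obtain p z where p: "p < P"
    "\<And>x. x \<in> ?U \<Longrightarrow> (\<And>i. i < p \<Longrightarrow> F x (z i) = 0) \<Longrightarrow> Re (F x x) \<le> 0"
    by blast
  let ?J = "Inl ` help1 \<union> Inr ` {..<p}"
  let ?\<psi> = "case_sum X_form (\<lambda>i x. F x (z i))"
  have "card ?J \<le> card help1 + p"
    by (intro order.trans[OF card_Un_le] add_mono)
      (auto intro: card_image_le finite_help order.trans[OF card_image_le])
  moreover have "form_energy n X_form s1 a \<le> M * sqnorm n a" if a: "a \<in> zero_space n ?J ?\<psi>" for a
  proof -
    have \<psi>: "?\<psi> j a = 0" if "j \<in> ?J" for j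
      using a that unfolding zero_space_def by blast
    have "Re (F a a) \<le> 0"
    proof (rule p(2))
      show "a \<in> ?U"
        using a \<psi>[of "Inl _"] by (auto simp: zero_space_def)
      show "F a (z i) = 0" if "i < p" for i
        using \<psi>[of "Inr i"] that by simp
    qed
    then show ?thesis by (simp add: Fxx)
  qed
  moreover have "\<forall>j\<in>?J. linear_form (?\<psi> j)"
    using lin hermitian_linear[OF F] by auto
  ultimately show ?thesis
    using p(1) finite_help by (intro exI[of _ ?J] exI[of _ ?\<psi>]) auto
qed

text \<open>\<open>X 0\<close> is a mere default for instructions that are not products.\<close>

fun left_factor :: "instr \<Rightarrow> operand" where
  "left_factor (Mul u v) = u"
| "left_factor _ = X 0"

definition factor :: "nat \<Rightarrow> (nat \<Rightarrow> complex) \<Rightarrow> complex" where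
  "factor t a = operand_val a (\<lambda>_. 0) (run a (\<lambda>_. 0) C) (left_factor (C ! t))"

lemma factor_cases:
  assumes "s2 \<le> t" "t < s3"
  obtains i where "i < n" "factor t = (\<lambda>a. a i)" | s where "s < s1" "factor t = X_form s"
proof -
  obtain u v where "u \<in> X ` {..<n} \<union> Res ` {..<s1}" "C ! t = Mul u v"
    using part3[OF assms] by blast
  then show ?thesis
    using that by (auto simp: factor_def[abs_def] X_form_def[abs_def])
qed

lemma linear_form_factor:
  assumes "s2 \<le> t" "t < s3"
  shows "linear_form (factor t)"
  using assms
proof (cases rule: factor_cases)
  case (1 i)
  then show ?thesis by (simp add: linear_form_def)
qed (simp add: linear_form_X_form)

lemma factor_bound:
  assumes "s2 \<le> t" "t < s3"
  shows "(cmod (factor t a))\<^sup>2 \<le> form_energy n X_form s1 a"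
  using assms
proof (cases rule: factor_cases)
  case (1 i)
  have "(cmod (a i))\<^sup>2 \<le> sqnorm n a"
    unfolding sqnorm_def using 1 by (intro member_le_sum) auto
  then show ?thesis
    unfolding form_energy_def using 1 by (simp add: add_increasing2 sum_nonneg)
next
  case (2 s)
  have "(cmod (X_form s a))\<^sup>2 \<le> (\<Sum>s<s1. (cmod (X_form s a))\<^sup>2)"
    using 2 by (intro member_le_sum) auto
  then show ?thesis
    unfolding form_energy_def using 2 sqnorm_nonneg[of n a] by simp
qed

text \<open>For fixed \<open>a\<close>, results of the first part are constant in \<open>b\<close>, hence not linear forms unless
  they vanish; they are replaced by \<open>0\<close>.\<close>

definition Y_form :: "(nat \<Rightarrow> complex) \<Rightarrow> nat \<Rightarrow> (nat \<Rightarrow> complex) \<Rightarrow> complex" where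
  "Y_form a t b = (if t < s1 then 0 else run a b C ! t)"

text \<open>An instruction after the first part acts on \<open>b\<close> as a linear instruction or, in the third
  part, as scaling by a value of the first part.\<close>

lemma Y_form_cases:
  assumes t: "s1 \<le> t" "t < length C"
  obtains
    (linear) "linear_instr (C ! t)" "\<not> (s2 \<le> t \<and> t < s3)"
      "\<And>b. Y_form a t b = instr_val a b (run a b C) (C ! t)"
      "\<And>u. u \<in> operands (C ! t) \<Longrightarrow> (\<exists>j<n. u = Y j) \<or> (\<exists>s<t. s1 \<le> s \<and> u = Res s)"
  | (product_input) j where "s2 \<le> t" "t < s3" "\<not> help_gate (C ! t)" "j < n"
      "\<And>b. Y_form a t b = factor t a * b j"
  | (product_result) s where "s2 \<le> t" "t < s3" "\<not> help_gate (C ! t)" "s < t" 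
      "\<And>b. Y_form a t b = factor t a * Y_form a s b"
proof (cases "s2 \<le> t \<and> t < s3")
  case True
  then obtain u v where uv: "u \<in> X ` {..<n} \<union> Res ` {..<s1}"
    "v \<in> Y ` {..<n} \<union> Res ` {s1..<s2}" "C ! t = Mul u v"
    using part3[of t] by blast
  have "operand_val a b (run a b C) u = factor t a" for b
    using uv(1) unfolding factor_def uv(3) by (auto simp: run_part1)
  then have Yt: "Y_form a t b = factor t a * operand_val a b (run a b C) v" for b
    using t uv(3) by (simp add: Y_form_def run_eq)
  from uv(2) show ?thesis
  proof
    assume "v \<in> Y ` {..<n}"
    then obtain j where "j < n" "v = Y j" by auto
    then show ?thesis
      using product_input[of j] True uv(3) Yt by simp
  next
    assume "v \<in> Res ` {s1..<s2}"
    then obtain s where s: "s1 \<le> s" "s < s2" "v = Res s" by auto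
    then show ?thesis
      using product_result[of s] True uv(3) Yt by (simp add: Y_form_def)
  qed
next
  case False
  have "linear_instr (C ! t) \<and> operands (C ! t) \<subseteq> Y ` {..<n} \<union> Res ` {s1..<t}"
  proof (cases "t < s2")
    case True
    then show ?thesis using part2[of t] t by simp
  next
    case nlt: False
    then have "operands (C ! t) \<subseteq> Res ` {s2..<t}" "linear_instr (C ! t)"
      using False part4[of t] t by auto
    moreover have "{s2..<t} \<subseteq> {s1..<t}" using parts by auto
    ultimately show ?thesis by blast
  qed
  then have "linear_instr (C ! t)"
    "\<And>u. u \<in> operands (C ! t) \<Longrightarrow> (\<exists>j<n. u = Y j) \<or> (\<exists>s<t. s1 \<le> s \<and> u = Res s)"
    by (blast, fastforce)
  moreover have "Y_form a t b = instr_val a b (run a b C) (C ! t)" for b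
    using t by (simp add: Y_form_def run_eq)
  ultimately show ?thesis using linear[OF _ False] by blast
qed

lemma linear_form_Y_form:
  assumes "t < length C"
  shows "linear_form (Y_form a t)"
  using assms
proof (induction t rule: less_induct)
  case (less t)
  show ?case
  proof (cases "t < s1")
    case True
    then show ?thesis by (simp add: Y_form_def linear_form_def)
  next
    case False
    then have "s1 \<le> t" by simp
    from this less.prems show ?thesis
    proof (cases rule: Y_form_cases[where a = a])
      case linear
      have "Y_form a t = (\<lambda>b. instr_val a b (run a b C) (C ! t))"
        using linear(3) by blast
      moreover have "linear_form \<dots>"
      proof (rule linear_form_instr_val[OF linear(1)])
        fix u assume u: "u \<in> operands (C ! t)"
        show "linear_form (\<lambda>b. operand_val a b (run a b C) u)"
          using linear(4)[OF u]
        proof (elim disjE exE conjE)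
          fix s assume s: "s < t" "s1 \<le> s" "u = Res s"
          then have "(\<lambda>b. operand_val a b (run a b C) u) = Y_form a s"
            by (simp add: Y_form_def fun_eq_iff)
          then show ?thesis using less.IH[OF s(1)] s less.prems by simp
        qed (simp add: linear_form_def)
      qed
      ultimately show ?thesis by simp
    next
      case (product_input j)
      then show ?thesis by (simp add: linear_form_def algebra_simps)
    next
      case (product_result s)
      then have "linear_form (Y_form a s)"
        using less.IH[of s] less.prems by simp
      then show ?thesis
        using product_result(5) by (simp add: linear_form_def algebra_simps)
    qed
  qed
qed

text \<open>The step constant for \<open>form_energy_growth\<close> applied to the circuit in
  \<open>b\<close>: a product scales by its left factor, and 4 comes from
  \<open>instr_val_bound\<close>.\<close>

definition amplification :: "(nat \<Rightarrow> complex) \<Rightarrow> nat \<Rightarrow> real" where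
  "amplification a t = (if s2 \<le> t \<and> t < s3 then (cmod (factor t a))\<^sup>2 else 4)"

lemma Y_form_step:
  assumes t: "t < length C" and b: "b \<in> zero_space n help2 (Y_form a)"
  shows "(cmod (Y_form a t b))\<^sup>2 \<le> amplification a t * form_energy n (Y_form a) t b"
proof -
  have input: "(cmod (b j))\<^sup>2 \<le> form_energy n (Y_form a) t b" if "j < n" for j
  proof -
    have "(cmod (b j))\<^sup>2 \<le> sqnorm n b"
      unfolding sqnorm_def using that by (intro member_le_sum) auto
    then show ?thesis
      unfolding form_energy_def by (simp add: add_increasing2 sum_nonneg)
  qed
  have result: "(cmod (Y_form a s b))\<^sup>2 \<le> form_energy n (Y_form a) t b" if "s < t" for s
  proof -
    have "(cmod (Y_form a s b))\<^sup>2 \<le> (\<Sum>s<t. (cmod (Y_form a s b))\<^sup>2)"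
      using that by (intro member_le_sum) auto
    then show ?thesis
      unfolding form_energy_def using sqnorm_nonneg[of n b] by simp
  qed
  have pos: "0 \<le> amplification a t * form_energy n (Y_form a) t b"
    by (simp add: amplification_def form_energy_def sqnorm_nonneg sum_nonneg)
  show ?thesis
  proof (cases "t < s1 \<or> help_gate (C ! t)")
    case True
    then have "Y_form a t b = 0"
      using b t by (cases "t < s1") (auto simp: Y_form_def zero_space_def help2_def)
    then show ?thesis using pos by simp
  next
    case False
    then have "s1 \<le> t" by simp
    from this t show ?thesis
    proof (cases rule: Y_form_cases[where a = a])
      case linear
      have "(cmod (instr_val a b (run a b C) (C ! t)))\<^sup>2 \<le> 4 * form_energy n (Y_form a) t b"
      proof (rule instr_val_bound[OF linear(1)])
        fix u assume u: "u \<in> operands (C ! t)"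
        show "(cmod (operand_val a b (run a b C) u))\<^sup>2 \<le> form_energy n (Y_form a) t b"
          using linear(4)[OF u] input result by (force simp: Y_form_def)
      qed (use False in simp)
      then show ?thesis using linear by (auto simp: amplification_def)
    next
      case (product_input j)
      then show ?thesis
        using input[of j] by (simp add: amplification_def norm_mult power_mult_distrib mult_left_mono)
    next
      case (product_result s)
      then show ?thesis
        using result[of s] by (simp add: amplification_def norm_mult power_mult_distrib mult_left_mono)
    qed
  qed
qed

end

section \<open>Lower bound for convolution circuits\<close>

locale bilinear_conv = bilinear_parts +
  assumes computes: "computes C n (conv n)"
begin

text \<open>An output computed in the first part does not depend on \<open>b\<close>, so it equals
  its value at \<open>b = 0\<close>, which is 0 as in \<open>Y_form\<close>. Convolving unit vectors
  separates the outputs; distinct positions make their squares distinct summands of the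
  energy.\<close>

lemma conv_outputs:
  "\<exists>\<tau>. inj_on \<tau> {..<n} \<and> (\<forall>k<n. \<tau> k < length C \<and> (\<forall>a b. Y_form a (\<tau> k) b = conv n a b k))"
proof -
  obtain \<tau> where \<tau>: "\<And>k. k < n \<Longrightarrow> \<tau> k < length C" "\<And>k a b. k < n \<Longrightarrow> run a b C ! \<tau> k = conv n a b k"
    using computes unfolding computes_def by metis
  have zero: "conv n a (\<lambda>_. 0) k = 0" for a k
    by (simp add: conv_def case_prod_beta)
  have "Y_form a (\<tau> k) b = conv n a b k" if k: "k < n" for k a b
  proof (cases "\<tau> k < s1")
    case True
    then have "run a b C ! \<tau> k = run a (\<lambda>_. 0) C ! \<tau> k"
      by (simp add: run_part1)
    then show ?thesis using True \<tau>(2)[OF k] zero by (simp add: Y_form_def)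
  qed (use \<tau>(2)[OF k] in \<open>simp add: Y_form_def\<close>)
  moreover have "inj_on \<tau> {..<n}"
  proof (rule inj_onI)
    fix k l assume kl: "k \<in> {..<n}" "l \<in> {..<n}" "\<tau> k = \<tau> l"
    let ?e = "\<lambda>l i. if i = l then 1 else 0 :: complex"
    let ?S = "\<lambda>m. {(i, j). i < n \<and> j < n \<and> (i + j) mod n = m mod n}"
    have "conv n (?e 0) (?e k) m = (if (0, k) \<in> ?S m then 1 else 0)" for m
    proof -
      have "finite (?S m)"
        by (rule finite_subset[of _ "{..<n} \<times> {..<n}"]) auto
      moreover have "conv n (?e 0) (?e k) m = (\<Sum>p\<in>?S m. if p = (0, k) then 1 else 0)"
        unfolding conv_def by (intro sum.cong refl) (auto split: if_splits)
      ultimately show ?thesis by (simp add: sum.delta)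
    qed
    then have "conv n (?e 0) (?e k) k = 1" "conv n (?e 0) (?e k) l = (if k = l then 1 else 0)"
      using kl by auto
    moreover have "conv n (?e 0) (?e k) k = conv n (?e 0) (?e k) l"
      using kl \<tau>(2) by (metis lessThan_iff)
    ultimately show "k = l" by (auto split: if_splits)
  qed
  ultimately show ?thesis using \<tau>(1) by blast
qed

lemma conv_energy: "sqnorm n (conv n a b) \<le> form_energy n (Y_form a) (length C) b"
proof -
  obtain \<tau> where \<tau>: "inj_on \<tau> {..<n}" "\<And>k. k < n \<Longrightarrow> \<tau> k < length C"
    "\<And>k. k < n \<Longrightarrow> Y_form a (\<tau> k) b = conv n a b k"
    using conv_outputs by blast
  have "sqnorm n (conv n a b) = (\<Sum>k<n. (cmod (Y_form a (\<tau> k) b))\<^sup>2)"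
    by (simp add: sqnorm_def \<tau>(3))
  also have "\<dots> = (\<Sum>t\<in>\<tau> ` {..<n}. (cmod (Y_form a t b))\<^sup>2)"
    by (simp add: sum.reindex[OF \<tau>(1)])
  also have "\<dots> \<le> (\<Sum>t<length C. (cmod (Y_form a t b))\<^sup>2)"
    using \<tau>(2) by (intro sum_mono2) auto
  finally show ?thesis
    using sqnorm_nonneg[of n b] by (simp add: form_energy_def)
qed

text \<open>Take \<open>b\<close> in the common zero space of the later help gates and of the
  Fourier coefficients outside \<open>K\<close>. Convolution with \<open>a\<close> expands the
  squared norm there by at least \<open>g\<close>, and the exponent bounds the dimension from
  below.\<close>

lemma volume_bound:
  assumes K: "K \<subseteq> {..<n}" "\<And>k. k \<in> K \<Longrightarrow> g \<le> n * (cmod (dft n k a))\<^sup>2" and g: "0 \<le> g"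
  shows "g ^ (n - (card help2 + (n - card K))) \<le> (\<Prod>t<length C. 1 + amplification a t)"
proof -
  define F where "F x y = (\<Sum>i<n. x i * cnj (y i))" for x y :: "nat \<Rightarrow> complex"
  have F: "hermitian F"
    unfolding hermitian_def linear_form_def F_def
    by (auto simp: algebra_simps sum.distrib sum_distrib_left)
  have Fxx: "F x x = of_real (sqnorm n x)" for x
    by (simp only: F_def sqnorm_def of_real_sum complex_norm_square)
  let ?J = "Inl ` help2 \<union> Inr ` ({..<n} - K)"
  let ?\<psi> = "case_sum (Y_form a) (dft n)"
  let ?m = "n - (card help2 + (n - card K))"
  have "card ?J = card help2 + card ({..<n} - K)"
    by (subst card_Un_disjoint) (auto simp: finite_help card_image)
  also have "card ({..<n} - K) = n - card K"
    using K(1) by (subst card_Diff_subset) (auto intro: finite_subset)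
  finally have J: "card ?J = card help2 + (n - card K)" .
  have Y: "linear_form (Y_form a t)" if "t \<in> help2" for t
    using that by (intro linear_form_Y_form) (simp add: help2_def)
  have lin: "linear_form (?\<psi> j)" if "j \<in> ?J" for j
    using that Y linear_form_dft by auto
  obtain z where z: "\<And>i. i < ?m \<Longrightarrow> z i \<in> zero_space n ?J ?\<psi>" "orthonormal F ?m z"
    using zero_space_orthonormal[OF F, of n ?J ?\<psi>] lin finite_help
    unfolding J Fxx Re_complex_of_real by (auto intro: sqnorm_pos)
  show ?thesis
  proof (rule form_energy_growth[where w = "Y_form a" and e = z and n = n])
    show "linear_form (Y_form a t)" if "t < length C" for t
      by (rule linear_form_Y_form[OF that])
    show "0 < sqnorm n (\<lambda>i. \<Sum>l<?m. c l * z l i)" if "\<exists>l<?m. c l \<noteq> 0" for c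
      by (rule orthonormal_sqnorm_pos[OF F z(2) _ that]) (use z(1) in \<open>auto simp: zero_space_def\<close>)
    show "0 \<le> amplification a t" for t
      by (simp add: amplification_def)
    fix c
    let ?b = "\<lambda>i. \<Sum>l<?m. c l * z l i"
    have b: "?b \<in> zero_space n ?J ?\<psi>"
      by (rule zero_space_sum) (use z(1) lin in auto)
    have \<psi>: "?\<psi> j ?b = 0" if "j \<in> ?J" for j
      using b that unfolding zero_space_def by blast
    have "?b \<in> zero_space n help2 (Y_form a)"
      using b \<psi>[of "Inl _"] by (auto simp: zero_space_def)
    then show "(cmod (Y_form a t ?b))\<^sup>2 \<le> amplification a t * form_energy n (Y_form a) t ?b"
      if "t < length C" for t
      by (rule Y_form_step[OF that])
    have "g * sqnorm n ?b = (\<Sum>k<n. g * (cmod (dft n k ?b))\<^sup>2)"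
      by (simp add: sum_distrib_left flip: parseval)
    also have "\<dots> \<le> (\<Sum>k<n. n * (cmod (dft n k a))\<^sup>2 * (cmod (dft n k ?b))\<^sup>2)"
    proof (rule sum_mono)
      fix k assume k: "k \<in> {..<n}"
      show "g * (cmod (dft n k ?b))\<^sup>2 \<le> n * (cmod (dft n k a))\<^sup>2 * (cmod (dft n k ?b))\<^sup>2"
      proof (cases "k \<in> K")
        case True
        then show ?thesis by (intro mult_right_mono K(2)) auto
      next
        case False
        then have "dft n k ?b = 0" using \<psi>[of "Inr k"] k by simp
        then show ?thesis by simp
      qed
    qed
    also have "\<dots> = sqnorm n (conv n a ?b)"
      by (rule sqnorm_conv[symmetric])
    also have "\<dots> \<le> form_energy n (Y_form a) (length C) ?b"
      by (rule conv_energy)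
    finally show "g * sqnorm n ?b \<le> form_energy n (Y_form a) (length C) ?b" .
  qed (rule g)
qed

lemma amplification_prod:
  "(\<Prod>t<length C. 1 + amplification a t)
     \<le> exp (2 * length C + (\<Sum>i<s3 - s2. (cmod (factor (s2 + i) a))\<^sup>2))"
proof -
  let ?q = "\<lambda>t. if s2 \<le> t \<and> t < s3 then (cmod (factor t a))\<^sup>2 else 0"
  have "(\<Prod>t<length C. 1 + amplification a t) \<le> (\<Prod>t<length C. exp (2 + ?q t))"
  proof (rule prod_mono)
    fix t
    \<comment> \<open>The quadratic Taylor polynomial of \<open>exp\<close> at 2 is 1 + 2 +
      2.\<close>
    have "(5::real) \<le> exp 2"
      using exp_lower_Taylor_quadratic[of 2] by simp
    moreover have "1 + x \<le> exp (2 + x)" for x :: real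
      by (rule order_trans[OF exp_ge_add_one_self]) simp
    ultimately show "0 \<le> 1 + amplification a t \<and> 1 + amplification a t \<le> exp (2 + ?q t)"
      by (auto simp: amplification_def)
  qed
  also have "\<dots> = exp (\<Sum>t<length C. 2 + ?q t)"
    by (simp add: exp_sum)
  also have "(\<Sum>t<length C. 2 + ?q t) = 2 * length C + (\<Sum>t\<in>{s2..<s3}. (cmod (factor t a))\<^sup>2)"
  proof -
    have "{..<length C} \<inter> {t. s2 \<le> t \<and> t < s3} = {s2..<s3}" using parts by auto
    then show ?thesis by (simp add: sum.distrib sum.If_cases)
  qed
  also have "(\<Sum>t\<in>{s2..<s3}. (cmod (factor t a))\<^sup>2) = (\<Sum>i<s3 - s2. (cmod (factor (s2 + i) a))\<^sup>2)"
    by (rule sum.reindex_bij_witness[of _ "\<lambda>i. s2 + i" "\<lambda>t. t - s2"]) auto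
  finally show ?thesis .
qed

text \<open>Of the \<open>4 * \<delta> * n\<close> dimensions left by the help gates,
  \<open>\<delta> * n\<close> each go to the bounded subspace, to the weight of the left factors and
  to the small Fourier coefficients; the last \<open>\<delta> * n\<close> is the exponent in
  \<open>volume_bound\<close>.\<close>

lemma size_lower_bound:
  fixes \<delta> :: real
  assumes \<delta>: "0 < \<delta>" and few: "real (num_help_gates C) \<le> (1 - 4 * \<delta>) * n"
    and n: "2 \<le> n" "1 \<le> n * \<delta> ^ 8"
  shows "\<delta>\<^sup>2 / (8 * \<delta> + 4) * (n * ln n) \<le> length C"
proof (rule ccontr)
  assume "\<not> ?thesis"
  then have small: "length C < \<delta>\<^sup>2 / (8 * \<delta> + 4) * (n * ln n)" by simp
  have ln: "0 < ln n" using n by simp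
  have nln: "0 < n * ln n" using n ln by simp
  define M where "M = sqrt n"
  have M: "1 \<le> M" "0 < M" "M * M = n" using n by (auto simp: M_def)
  define P where "P = nat \<lfloor>\<delta> * n\<rfloor> + 1"
  have P: "\<delta> * n < P" "real (P - 1) \<le> \<delta> * n"
    using \<delta> floor_correct[of "\<delta> * n"] by (auto simp: P_def add.commute)
  \<comment> \<open>The assumed size bound gives \<open>s1 < \<delta> / 4 * (n * ln n)\<close>, and
    \<open>M ^ P\<close> is \<open>exp (P * (ln n / 2))\<close> with \<open>P\<close> just above
    \<open>\<delta> * n\<close>.\<close>
  have "5 ^ s1 < M ^ P"
  proof -
    have "(5::real) \<le> exp 2"
      using exp_lower_Taylor_quadratic[of 2] by simp
    then have "(5::real) ^ s1 \<le> exp 2 ^ s1"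
      by (intro power_mono) auto
    also have "\<dots> = exp (2 * real s1)"
      by (rule exp_of_nat2_mult[symmetric])
    also have "exp (2 * real s1) < exp (P * (ln n / 2))"
    proof -
      have "\<delta>\<^sup>2 / (8 * \<delta> + 4) \<le> \<delta> / 4"
        using \<delta> by (simp add: field_simps power2_eq_square)
      then have "\<delta>\<^sup>2 / (8 * \<delta> + 4) * (n * ln n) \<le> \<delta> / 4 * (n * ln n)"
        using nln by (intro mult_right_mono) auto
      moreover have "real s1 \<le> length C" using parts by simp
      ultimately have "real s1 < \<delta> / 4 * (n * ln n)" using small by linarith
      then have "2 * real s1 < (\<delta> * n) * (ln n / 2)" by simp
      also have "\<dots> < P * (ln n / 2)"
        using P ln by (intro mult_strict_right_mono) auto
      finally show ?thesis by simp
    qed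
    also have "\<dots> = M ^ P"
      using n by (simp add: M_def exp_of_nat_mult ln_sqrt[symmetric])
    finally show ?thesis .
  qed
  then obtain J :: "(nat + nat) set" and \<psi> where J: "finite J" "card J < card help1 + P"
    "\<And>j. j \<in> J \<Longrightarrow> linear_form (\<psi> j)"
    "\<And>a. a \<in> zero_space n J \<psi> \<Longrightarrow> form_energy n X_form s1 a \<le> M * sqnorm n a"
    using ex_small_space[OF _ M(1)] by metis
  define N where "N = s3 - s2"
  \<comment> \<open>Chosen so that the loss \<open>\<kappa> * N * M\<close> is
    \<open>\<delta> * n\<close>; for \<open>N = 0\<close> division by zero gives 0, which is
    harmless.\<close>
  define \<kappa> where "\<kappa> = \<delta> * n / (N * M)"
  have \<kappa>: "0 \<le> \<kappa>" using \<delta> M by (simp add: \<kappa>_def)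
  obtain u where u: "\<kappa> * (\<Sum>i<N. (cmod (factor (s2 + i) u))\<^sup>2) \<le> n"
    "real n - card J - \<kappa> * N * M - \<delta> * n \<le> card {k. k < n \<and> \<delta> \<le> cmod (dft n k u)}"
  proof -
    have "\<exists>u\<in>zero_space n J \<psi>. \<kappa> * (\<Sum>i<N. (cmod (factor (s2 + i) u))\<^sup>2) \<le> n \<and>
           real n - card J - \<kappa> * N * M - \<delta> * n \<le> card {k. k < n \<and> \<delta> \<le> cmod (dft n k u)}"
    proof (rule ex_large_values)
      show "linear_form (factor (s2 + i))" if "i < N" for i
        using that by (intro linear_form_factor) (auto simp: N_def)
      show "(cmod (factor (s2 + i) x))\<^sup>2 \<le> M * sqnorm n x" if "x \<in> zero_space n J \<psi>" "i < N" for x i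
        using that by (intro order_trans[OF factor_bound J(4)]) (auto simp: N_def)
    qed (use J \<kappa> \<delta> M linear_form_dft parseval in auto)
    then show ?thesis using that by blast
  qed
  define K where "K = {k. k < n \<and> \<delta> \<le> cmod (dft n k u)}"
  \<comment> \<open>The squared left factors at \<open>u\<close> sum to at most
    \<open>N * M / \<delta>\<close>. Rescaling removes the factor \<open>M\<close>, so the products
    cost only \<open>O(N)\<close> in the exponent, while the expansion \<open>g\<close> is still
    \<open>sqrt n * \<delta>\<^sup>2\<close>.\<close>
  define a where "a = (\<lambda>i. of_real (1 / sqrt M) * u i)"
  define g where "g = n * (\<delta>\<^sup>2 / M)"
  let ?m = "n - (card help2 + (n - card K))"
  have scale: "(cmod (\<phi> a))\<^sup>2 = (cmod (\<phi> u))\<^sup>2 / M" if "linear_form \<phi>" for \<phi>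
    unfolding a_def linear_form_scale[OF that] using M
    by (simp add: norm_mult power_mult_distrib norm_divide power_divide)
  have "(\<Sum>i<N. (cmod (factor (s2 + i) a))\<^sup>2) \<le> N / \<delta>"
  proof (cases "N = 0")
    case False
    have "linear_form (factor (s2 + i))" if "i < N" for i
      using that by (intro linear_form_factor) (auto simp: N_def)
    then have "(\<Sum>i<N. (cmod (factor (s2 + i) a))\<^sup>2) = (\<Sum>i<N. (cmod (factor (s2 + i) u))\<^sup>2) / M"
      by (simp add: scale sum_divide_distrib)
    also have "\<dots> \<le> N / \<delta>"
      using u(1) False \<delta> M n by (simp add: \<kappa>_def field_simps)
    finally show ?thesis .
  qed simp
  also have "\<dots> \<le> length C / \<delta>"
    using parts \<delta> by (intro divide_right_mono) (auto simp: N_def)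
  finally have Q: "(\<Sum>i<N. (cmod (factor (s2 + i) a))\<^sup>2) \<le> length C / \<delta>" .
  have g0: "0 < g" using n \<delta> M by (simp add: g_def)
  have "g ^ ?m \<le> (\<Prod>t<length C. 1 + amplification a t)"
  proof (rule volume_bound)
    show "K \<subseteq> {..<n}" by (auto simp: K_def)
    show "g \<le> n * (cmod (dft n k a))\<^sup>2" if "k \<in> K" for k
    proof -
      have "\<delta>\<^sup>2 \<le> (cmod (dft n k u))\<^sup>2"
        using that \<delta> by (intro power_mono) (auto simp: K_def)
      then show ?thesis
        unfolding g_def scale[OF linear_form_dft] using M by (intro mult_left_mono divide_right_mono) auto
    qed
  qed (use g0 in simp)
  also have "\<dots> \<le> exp (2 * length C + length C / \<delta>)"
    using Q by (intro order_trans[OF amplification_prod]) (simp add: N_def)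
  finally have "ln (g ^ ?m) \<le> ln (exp (2 * length C + length C / \<delta>))"
    using g0 by (subst ln_le_cancel_iff) simp_all
  then have upper: "?m * ln g \<le> 2 * length C + length C / \<delta>"
    using g0 by (simp add: ln_realpow)
  have "ln g = ln n / 2 + 2 * ln \<delta>"
  proof -
    have "g = M * \<delta>\<^sup>2" using M by (simp add: g_def field_simps flip: M(3))
    then show ?thesis using M \<delta> n by (simp add: ln_mult ln_realpow M_def ln_sqrt)
  qed
  \<comment> \<open>This is where \<open>1 \<le> n * \<delta> ^ 8\<close> enters: it lets a quarter
    of \<open>ln n\<close> absorb \<open>2 * ln \<delta>\<close>.\<close>
  moreover have "0 \<le> ln n + 8 * ln \<delta>"
  proof -
    have "0 \<le> ln (n * \<delta> ^ 8)" using n(2) by simp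
    then show ?thesis using \<delta> n(1) by (simp add: ln_mult ln_realpow)
  qed
  ultimately have lng: "ln n / 4 \<le> ln g" by simp
  have "\<delta> * n \<le> ?m"
  proof -
    have "\<kappa> * N * M \<le> \<delta> * n"
      using M \<delta> by (cases "N = 0") (auto simp: \<kappa>_def)
    moreover have "card J \<le> card help1 + (P - 1)" using J(2) by (simp add: P_def)
    then have "real (card J) \<le> card help1 + \<delta> * n" using P(2) by linarith
    moreover have "real (card help1) + card help2 \<le> (1 - 4 * \<delta>) * n"
      using few card_help by (metis of_nat_add)
    ultimately have "\<delta> * n \<le> real (card K) - card help2"
      using u(2) unfolding K_def[symmetric] by (simp add: algebra_simps)
    moreover have "card K \<le> n"
      using card_mono[of "{..<n}" K] by (auto simp: K_def)
    ultimately show ?thesis by linarith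
  qed
  then have "\<delta> * n * (ln n / 4) \<le> ?m * ln g"
    using lng ln \<delta> by (intro mult_mono) auto
  with upper have "\<delta> * (n * ln n) \<le> 4 * (2 * length C + length C / \<delta>)" by simp
  then have "\<delta>\<^sup>2 * (n * ln n) \<le> (8 * \<delta> + 4) * length C"
    using \<delta> by (simp add: field_simps power2_eq_square)
  then have "\<delta>\<^sup>2 / (8 * \<delta> + 4) * (n * ln n) \<le> length C"
    using \<delta> by (simp add: divide_le_eq mult.commute)
  with small show False by simp
qed

end

section \<open>A convolution circuit without scalar multiplications\<close>

lemma linear_circuit_snoc:
  assumes "linear_circuit I s q" "linear_instr g" "operands g \<subseteq> I \<union> Res ` {s..<s + length q}"
  shows "linear_circuit I s (q @ [g])"
  using assms by (simp add: linear_circuit_def circuit_def nth_append less_Suc_eq)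

text \<open>Each further summand costs one addition, and a single summand is already a result of
  \<open>p\<close>. The prefix \<open>q\<close> lets the sums for successive outputs be appended one
  after another.\<close>

lemma ex_sum_circuit:
  fixes p q :: "instr list"
  assumes "finite T" "T \<noteq> {}" "T \<subseteq> {..<length p}"
    and "linear_circuit (Res ` {0..<length p}) (length p) q" "num_help_gates q = 0"
  shows "\<exists>q'. linear_circuit (Res ` {0..<length p}) (length p) (q @ q') \<and> num_help_gates (q @ q') = 0 \<and>
     (\<exists>t<length (p @ q @ q'). \<forall>a b. run a b (p @ q @ q') ! t = (\<Sum>s\<in>T. run a b p ! s))"
  using assms
proof (induction T rule: finite_ne_induct)
  case (singleton t)
  then show ?case by (intro exI[of _ "[]"]) (auto simp: run_append_nth intro!: exI[of _ t])
next
  case (insert x T)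
  let ?lin = "linear_circuit (Res ` {0..<length p}) (length p)"
  obtain q' t where q': "?lin (q @ q')" "num_help_gates (q @ q') = 0" "t < length (p @ q @ q')"
    "\<And>a b. run a b (p @ q @ q') ! t = (\<Sum>s\<in>T. run a b p ! s)"
    using insert.IH insert.prems by auto
  let ?g = "Add (Res x) (Res t)"
  have x: "x < length p" using insert.prems by simp
  have "?lin ((q @ q') @ [?g])"
  proof (rule linear_circuit_snoc[OF q'(1)])
    show "operands ?g \<subseteq> Res ` {0..<length p} \<union> Res ` {length p..<length p + length (q @ q')}"
      using q'(3) x by (cases "t < length p") auto
  qed simp
  moreover have "num_help_gates (q @ q' @ [?g]) = 0"
    using q'(2) by (simp add: num_help_gates_def)
  moreover have "run a b (p @ q @ q' @ [?g]) ! length (p @ q @ q') = (\<Sum>s\<in>insert x T. run a b p ! s)" for a b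
  proof -
    have "run a b (p @ q @ q' @ [?g]) = run a b (p @ q @ q') @ [instr_val a b (run a b (p @ q @ q')) ?g]"
      using run_snoc[of a b "p @ q @ q'" ?g] by simp
    then show ?thesis
      using q'(4) x insert.hyps by (simp add: nth_append run_append_nth)
  qed
  ultimately show ?case
    by (intro exI[of _ "q' @ [?g]"]) (auto intro!: exI[of _ "length (p @ q @ q')"])
qed

text \<open>Shows that the minimum in \<open>min_size_conv\<close> is over a nonempty set, so that
  \<open>LEAST\<close> is attained by an actual circuit.\<close>

lemma ex_circuit_conv:
  "\<exists>C. bilinear_circuit n n C \<and> computes C n (conv n) \<and> num_help_gates C = 0"
proof -
  define ps where "ps = List.product [0..<n] [0..<n]"
  have ps: "set ps = {..<n} \<times> {..<n}" "distinct ps"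
    by (auto simp: ps_def distinct_product)
  define p where "p = map (\<lambda>(i, j). Mul (X i) (Y j)) ps"
  have pt: "run a b p ! t = a (fst (ps ! t)) * b (snd (ps ! t))" if "t < length ps" for t a b
  proof -
    have "p ! t = Mul (X (fst (ps ! t))) (Y (snd (ps ! t)))"
      using that by (simp add: p_def case_prod_beta)
    then show ?thesis using that run_nth[of t p a b] by (simp add: p_def)
  qed
  have nth_bij: "bij_betw ((!) ps) {t. t < length p \<and> ps ! t \<in> S} S" if "S \<subseteq> set ps" for S
  proof (rule bij_betw_subset[OF bij_betw_nth[OF ps(2) refl refl]])
    show "(!) ps ` {t. t < length p \<and> ps ! t \<in> S} = S"
    proof (intro equalityI subsetI)
      fix r assume "r \<in> S"
      with that obtain t where "t < length ps" "ps ! t = r" by (metis in_set_conv_nth subsetD)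
      with \<open>r \<in> S\<close> show "r \<in> (!) ps ` {t. t < length p \<and> ps ! t \<in> S}"
        by (intro image_eqI[of _ _ t]) (simp_all add: p_def)
    qed auto
  qed (auto simp: p_def)
  let ?lin = "linear_circuit (Res ` {0..<length p}) (length p)"
  have "\<exists>q. ?lin q \<and> num_help_gates q = 0 \<and> computes (p @ q) k (conv n)" if "k \<le> n" for k
    using that
  proof (induction k)
    case 0
    show ?case
      by (intro exI[of _ "[]"]) (simp add: linear_circuit_def circuit_def num_help_gates_def computes_def)
  next
    case (Suc k)
    then obtain q where q: "?lin q" "num_help_gates q = 0" "computes (p @ q) k (conv n)" by auto
    define S where "S = {(i, j). i < n \<and> j < n \<and> (i + j) mod n = k mod n}"
    define T where "T = {t. t < length p \<and> ps ! t \<in> S}"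
    have "S \<subseteq> set ps" by (auto simp: ps S_def)
    then have bij: "bij_betw ((!) ps) T S"
      unfolding T_def by (rule nth_bij)
    \<comment> \<open>The sum must be nonempty, since an empty one would not be produced by
      additions of products.\<close>
    have "(0, k) \<in> S" using Suc.prems by (simp add: S_def)
    then have "T \<noteq> {}"
      using bij by (auto simp: bij_betw_def)
    moreover have "finite T" "T \<subseteq> {..<length p}" by (auto simp: T_def)
    ultimately obtain q' t where q': "?lin (q @ q')" "num_help_gates (q @ q') = 0" "t < length (p @ q @ q')"
      "\<And>a b. run a b (p @ q @ q') ! t = (\<Sum>s\<in>T. run a b p ! s)"
      using ex_sum_circuit[of T p q] q(1,2) by metis
    have "(\<Sum>s\<in>T. run a b p ! s) = conv n a b k" for a b
    proof -
      have "(\<Sum>s\<in>T. run a b p ! s) = (\<Sum>s\<in>T. a (fst (ps ! s)) * b (snd (ps ! s)))"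
        by (intro sum.cong refl pt) (simp add: p_def T_def)
      also have "\<dots> = (\<Sum>r\<in>S. a (fst r) * b (snd r))"
        by (rule sum.reindex_bij_betw[OF bij])
      finally show ?thesis by (simp add: conv_def S_def case_prod_beta)
    qed
    then have "\<exists>t<length (p @ q @ q'). \<forall>a b. run a b (p @ q @ q') ! t = conv n a b k"
      using q'(3,4) by auto
    moreover have "\<exists>t<length (p @ q @ q'). \<forall>a b. run a b (p @ q @ q') ! t = conv n a b j" if "j < k" for j
    proof -
      have "\<exists>t<length (p @ q). \<forall>a b. run a b (p @ q) ! t = conv n a b j"
        using q(3) that by (simp add: computes_def)
      then obtain t where t: "t < length (p @ q)" "\<forall>a b. run a b (p @ q) ! t = conv n a b j"
        by (elim exE conjE)
      have "run a b (p @ q @ q') ! t = conv n a b j" for a b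
        using run_append_nth[OF t(1), of a b q'] t(2) by simp
      then show ?thesis using t(1) by (intro exI[of _ t]) simp
    qed
    ultimately have "computes (p @ q @ q') (Suc k) (conv n)"
      by (auto simp: computes_def less_Suc_eq)
    then show ?case using q' by blast
  qed
  then obtain q where q: "?lin q" "num_help_gates q = 0" "computes (p @ q) n (conv n)" by blast
  have "bilinear_circuit n n (p @ q)"
    unfolding bilinear_circuit_def
  proof (intro exI conjI)
    show "p @ q = [] @ [] @ p @ q" by simp
    show "\<forall>g\<in>set p. \<exists>u\<in>X ` {..<n} \<union> Res ` {..<length []}.
        \<exists>v\<in>Y ` {..<n} \<union> Res ` {length []..<length ([] @ [])}. g = Mul u v"
      by (auto simp: p_def ps)
  qed (use q(1) in \<open>simp_all add: linear_circuit_def circuit_def\<close>)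
  moreover have "num_help_gates (p @ q) = 0"
    using q(2) by (auto simp: num_help_gates_def p_def filter_empty_conv)
  ultimately show ?thesis using q(3) by blast
qed

theorem theorem6p4:
  fixes \<epsilon> :: real
  assumes "0 < \<epsilon>" and "\<epsilon> \<le> 1"
  shows "\<exists>c::real. c > 0 \<and>
           (\<forall>n\<ge>2. real (min_size_conv \<epsilon> n) \<ge> c * (real n * ln (real n)))"
proof -
  define \<delta> where "\<delta> = \<epsilon> / 4"
  have \<delta>: "0 < \<delta>" using assms by (simp add: \<delta>_def)
  \<comment> \<open>The second entry serves the finitely many \<open>n\<close> with
    \<open>n * \<delta> ^ 8 < 1\<close>: there \<open>n * ln n \<le> n * n\<close> brings the bound
    below 1, and a circuit with an output has at least one instruction.\<close>
  define c where "c = min (\<delta>\<^sup>2 / (8 * \<delta> + 4)) ((\<delta> ^ 8)\<^sup>2)"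
  have "0 < c" using \<delta> by (simp add: c_def)
  moreover have "c * (n * ln n) \<le> min_size_conv \<epsilon> n" if n: "2 \<le> n" for n :: nat
  proof -
    have nln: "0 \<le> n * ln n" using n by simp
    obtain C0 where "bilinear_circuit n n C0" "computes C0 n (conv n)" "num_help_gates C0 = 0"
      using ex_circuit_conv by blast
    moreover have "0 \<le> (1 - \<epsilon>) * n" using assms by simp
    ultimately have "\<exists>s C. bilinear_circuit n n C \<and> computes C n (conv n) \<and>
        real (num_help_gates C) \<le> (1 - \<epsilon>) * real n \<and> length C = s"
      by (intro exI[of _ "length C0"] exI[of _ C0]) simp
    from LeastI_ex[OF this] obtain C where C: "bilinear_circuit n n C" "computes C n (conv n)"
      "real (num_help_gates C) \<le> (1 - \<epsilon>) * real n" "length C = min_size_conv \<epsilon> n"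
      unfolding min_size_conv_def by blast
    obtain s1 s2 s3 where "bilinear_parts n C s1 s2 s3"
      using bilinear_circuit_parts[OF C(1)] by blast
    then interpret bilinear_conv n C s1 s2 s3
      using C(2) by (simp add: bilinear_conv_def bilinear_conv_axioms_def)
    show ?thesis
    proof (cases "1 \<le> n * \<delta> ^ 8")
      case True
      have "c * (n * ln n) \<le> \<delta>\<^sup>2 / (8 * \<delta> + 4) * (n * ln n)"
        using nln by (intro mult_right_mono) (simp_all add: c_def)
      also have "\<dots> \<le> length C"
        by (rule size_lower_bound[OF \<delta> _ n True]) (use C(3) in \<open>simp add: \<delta>_def\<close>)
      finally show ?thesis using C(4) by simp
    next
      case False
      have "\<exists>t<length C. \<forall>a b. run a b C ! t = conv n a b 0"
        using C(2) n by (simp add: computes_def)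
      then have "1 \<le> length C" by auto
      have "ln n \<le> n" using n ln_le_minus_one[of n] by simp
      then have "real n * ln n \<le> real n * real n" by (intro mult_left_mono) auto
      then have "c * (n * ln n) \<le> (\<delta> ^ 8)\<^sup>2 * (n * n)"
        using nln by (intro mult_mono) (simp_all add: c_def)
      also have "\<dots> = (n * \<delta> ^ 8)\<^sup>2" by (simp add: power2_eq_square)
      also have "\<dots> \<le> 1"
        using False \<delta> by (intro power_le_one) auto
      also have "1 \<le> real (length C)"
        using \<open>1 \<le> length C\<close> by simp
      finally show ?thesis using C(4) by simp
    qed
  qed
  ultimately show ?thesis by blast
qed

end
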